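(* In the Markov game with parametrized policies described in the context, let the parameters $\theta_{j,t}$ and beliefs $\hat\theta^i_{j,t}$ be generated by networked policy gradient play. Assume: (A1) The graph $(\mathcal{N},\mathcal{E}_\infty)$, $\mathcal{E}_\infty=\{(i,j): (i,j)\in\mathcal{E}_t \text{ for infinitely many } t\in\mathbb{N}\}$, is connected, and there is an integer $T_{\mathcal{G}}>0$ such that for every $(i,j)\in\mathcal{E}_\infty$ and every $t\ge1$, $(i,j)\in\bigcup_{\tau=0}^{T_{\mathcal{G}}-1}\mathcal{E}_{t+\tau}$. (A2) There is $h\in(0,1)$ such that for all $i,j\in\mathcal{N}$ and $t\ge1$: (i) if $i\ne j$, then $w^i_{jl,t}\ge h$ for $l\in\mathcal{N}_{i,t}\cup\{i\}$ and $w^i_{jl,t}=0$ otherwise; (ii) $w^j_{jj,t}=1$; (iii) $\sum_{l\in\mathcal{N}}w^i_{jl,t}=1$ (all weights nonnegative). (A3) There is $\kappa\ge0$ with $\mathbb{E}[|\hat\theta^i_{j,0}(m)-\theta_{j,0}(m)|]\le\kappa$ for all $i\neq j$ and every coordinate $m$; and $\hat\theta^j_{j,0}=\theta_{j,0}$ for all $j$. (A4) The step sizes $\alpha_t>0$ satisfy $\alpha_t=\mathcal{O}(t^{-\beta})$ with $\beta\in(1/2,1)$. (A5) There is $R>0$ with $|r_i(s,a)|\le R$ for all $i\in\mathcal{N}$, $(s,a)\in\mathcal{S}\times\mathcal{A}^N$. (A6) There are $B,V,\mathcal{L}\ge0$ such that for all $i,n\in\mathcal{N}$, $\theta\in\mathbb{R}^M$,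 $s\in\mathcal{S}$: $\mathbb{E}_{a_n\sim\pi_{n,\theta}(\cdot|s)}\|\nabla_i\log\pi_{n,\theta}(a_n|s)\|\le B$ and $\mathbb{E}_{a_n\sim\pi_{n,\theta}(\cdot|s)}\|\nabla_i\log\pi_{n,\theta}(a_n|s)\|^2\le V^2$; and for all $\theta^1,\theta^2\in\mathbb{R}^M$, $s$, $a_n$: $\|\nabla_i\log\pi_{n,\theta^1}(a_n|s)-\nabla_i\log\pi_{n,\theta^2}(a_n|s)\|\le\mathcal{L}\|\theta^1-\theta^2\|$. Then for all $i,j\in\mathcal{N}$ the local copies converge to the true parameters in expectation at rate $t^{-\beta}$: $\mathbb{E}[\|\hat\theta^i_{j,t}-\theta_{j,t}\|]=\mathcal{O}(t^{-\beta})$.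
   Context: **Game.** Agents $\mathcal{N}=\{1,\dots,N\}$, common action set $\mathcal{A}\subseteq\mathbb{R}^K$ and state space $\mathcal{S}$ (not necessarily finite), transition law $\mathbb{P}(s'|s,a)$ for joint actions $a\in\mathcal{A}^N$, rewards $r_i:\mathcal{S}\times\mathcal{A}^N\to\mathbb{R}$, discount $\gamma\in(0,1)$, and a fixed initial state $s_0$ (suppressed from the notation). Joint parameter $\theta=(\theta_1,\dots,\theta_N)\in\mathbb{R}^M$, $\theta_i\in\mathbb{R}^{M_i}$, $\sum_iM_i=M$. Each agent $n$ has a smooth, differentiable policy (density or mass function) $\pi_{n,\theta}(a_n|s)$ which may depend on the whole vector $\theta$; the joint policy is $\Pi_\theta(a|s)=\prod_{n}\pi_{n,\theta}(a_n|s)$. $\nabla_i$ is the gradient with respect to $\theta_i$. Utilities: $u_i(\theta)=u_i(\theta_i,\theta_{-i})=\mathbb{E}[\sum_{t\ge0}\gamma^tr_i(s_t,a_t)\mid s_0]$ with $a_t\sim\Pi_\theta(\cdot|s_t)$ and $s_{t+1}\sim\mathbb{P}(\cdot|s_t,a_t)$. **Gradient estimator $\hat\nabla_iu_i(\theta)$ at $\theta$.** $\mathrm{Geom}(p)$ is the law on $\{0,1,\dots\}$ with $\mathbb{P}(x)=(1-p)^xp$. Draw $\mathcal{T}_1\sim\mathrm{Geom}(1-\gamma)$, run the Markov chain from $s_0$ under $\Pi_\theta$ for $\mathcal{T}_1$ steps, and record $(s_{\mathcal{T}_1},a_{\mathcal{T}_1})$. Then set $$\hat\nabla_iu_i(\theta)=\frac1{1-\gamma}\hat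 R_i\sum_{n\in\mathcal{N}}\nabla_i\log\pi_{n,\theta}(a_{n,\mathcal{T}_1}|s_{\mathcal{T}_1}),$$ where $\hat R_i$ is one of: (Q) $\hat Q_i=\sum_{t=\mathcal{T}_1}^{\mathcal{T}_1+\mathcal{T}_2}\gamma^{(t-\mathcal{T}_1)/2}r_i(s_t,a_t)$, continuing the chain from $(s_{\mathcal{T}_1},a_{\mathcal{T}_1})$ under $\Pi_\theta$, with $\mathcal{T}_2\sim\mathrm{Geom}(1-\gamma^{1/2})$ independent; (advantage) $\hat Q_i-\hat V_i(s_{\mathcal{T}_1})$; (temporal difference) $r_i(s_{\mathcal{T}_1},a_{\mathcal{T}_1})+\gamma\hat V_i(s_{\mathcal{T}_1+1})-\hat V_i(s_{\mathcal{T}_1})$. Here $\hat V_i(s)$ is the same kind of sum of $\gamma^{k/2}r_i$, $k=0,\dots,\mathcal{T}_2'$, along a fresh trajectory started at state $s$ under $\Pi_\theta$, with independent $\mathcal{T}_2'\sim\mathrm{Geom}(1-\gamma^{1/2})$; the estimate $\hat V_i(s_{\mathcal{T}_1})$ is conditionally independent of everything else given $s_{\mathcal{T}_1}$. **Networked policy gradient play.** $\mathcal{G}_t=(\mathcal{N},\mathcal{E}_t)$ is a given sequence of undirected graphs, $\mathcal{N}_{i,t}=\{j:(i,j)\in\mathcal{E}_t\}$, and $w^i_{jl,t}\ge0$ are given weights. Agent $i$ keeps a belief $\hat\theta^i_{j,t}\in\mathbb{R}^{M_j}$ about $\theta_{j,t}$ for each $j$, with $\hat\theta^j_{j,t}=\theta_{j,t}$;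 $x(m)$ denotes the $m$-th coordinate of $x$. Starting from (possibly random) $\theta_0$ and beliefs $\hat\theta^i_{j,0}$, at each $t=1,2,\dots$: (1) each agent $i$ produces, with fresh randomness given the past, the estimator $\hat\nabla_iu_i(\theta_{i,t-1},\hat\theta^i_{-i,t-1})$, i.e. the estimator above evaluated at the joint parameter formed from its own parameter and its beliefs; (2) $\theta_{i,t}=\theta_{i,t-1}+\alpha_t\hat\nabla_iu_i(\theta_{i,t-1},\hat\theta^i_{-i,t-1})$; (3) beliefs are updated by consensus: writing $\hat\theta_{j}(m)\in\mathbb{R}^N$ for the vector $(\hat\theta^1_j(m),\dots,\hat\theta^N_j(m))$, $W_{j,t}=(w^i_{jl,t})_{i,l}$, and $e_j$ for the $j$-th canonical basis vector of $\mathbb{R}^N$, $\hat\theta_{j,t}(m)=W_{j,t}\big(\hat\theta_{j,t-1}(m)+(\theta_{j,t}(m)-\theta_{j,t-1}(m))e_j\big)$. *)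

theory Defs
  imports "HOL-Probability.Probability" "HOL-Library.Landau_Symbols"
begin

text \<open>
  Agents are the elements of a finite type \<open>'n\<close>, actions are points of \<open>real^'k\<close>.
  The field \<open>actions\<close> is the common action set (its \<open>space\<close>) together with the reference
  measure with respect to which the policies have densities: Lebesgue measure on the action
  set gives density functions, counting measure gives mass functions.  The measure carried by
  \<open>states\<close> is irrelevant; only its \<open>\<sigma>\<close>-algebra is used.
\<close>

record ('s, 'n, 'k) markov_game =
  states :: "'s measure"
  actions :: "(real^'k) measure"
  trans :: "'s \<times> ('n \<Rightarrow> real^'k) \<Rightarrow> 's measure"
  reward :: "'n \<Rightarrow> 's \<times> ('n \<Rightarrow> real^'k) \<Rightarrow> real"
  discount :: real
  init_state :: 's

definition joint_actions :: "('s, 'n::finite, 'k::finite) markov_game \<Rightarrow> ('n \<Rightarrow> real^'k) measure" where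
  "joint_actions G = PiM UNIV (\<lambda>_. actions G)"

definition state_actions ::
  "('s, 'n::finite, 'k::finite) markov_game \<Rightarrow> ('s \<times> ('n \<Rightarrow> real^'k)) measure" where
  "state_actions G = states G \<Otimes>\<^sub>M joint_actions G"

definition wf_game :: "('s, 'n::finite, 'k::finite) markov_game \<Rightarrow> bool" where
  "wf_game G \<longleftrightarrow>
     trans G \<in> state_actions G \<rightarrow>\<^sub>M prob_algebra (states G) \<and>
     (\<forall>i. reward G i \<in> borel_measurable (state_actions G)) \<and>
     0 < discount G \<and> discount G < 1 \<and>
     init_state G \<in> space (states G)"

text \<open>
  The joint parameter is a vector in \<open>real^'m\<close>; the function \<open>own :: 'm \<Rightarrow> 'n\<close> says which
  agent each coordinate belongs to, so that the parameter of agent \<open>i\<close> consists of the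
  coordinates \<open>m\<close> with \<open>own m = i\<close>.  The parameter spaces of different agents may thus have
  different dimensions.  The parameter space of agent \<open>i\<close> is embedded isometrically in
  \<open>real^'m\<close> by filling up with zeros.
\<close>

definition block :: "('m \<Rightarrow> 'n) \<Rightarrow> 'n \<Rightarrow> real^'m \<Rightarrow> real^'m::finite" where
  "block own i v = (\<chi> m. if own m = i then v $ m else 0)"

definition block_grad :: "('m \<Rightarrow> 'n) \<Rightarrow> 'n \<Rightarrow> (real^'m \<Rightarrow> real) \<Rightarrow> real^'m \<Rightarrow> real^'m::finite" where
  "block_grad own i f \<theta> = block own i (\<chi> m. frechet_derivative f (at \<theta>) (axis m 1))"

text \<open>\<open>\<pi> n \<theta> s a\<close> is the density (or mass) of action \<open>a\<close> of agent \<open>n\<close> in state \<open>s\<close>.\<close>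

type_synonym ('s, 'n, 'k, 'm) policy = "'n \<Rightarrow> real^'m \<Rightarrow> 's \<Rightarrow> real^'k \<Rightarrow> real"

definition policy_law ::
  "('s, 'n::finite, 'k::finite) markov_game \<Rightarrow> ('s, 'n, 'k, 'm::finite) policy \<Rightarrow>
   'n \<Rightarrow> real^'m \<Rightarrow> 's \<Rightarrow> (real^'k) measure" where
  "policy_law G \<pi> n \<theta> s = density (actions G) (\<lambda>a. ennreal (\<pi> n \<theta> s a))"

text \<open>
  The last condition gives meaning to the gradient of the log-policy.  It follows from the
  previous one if the policy is positive; since \<open>ln 0 = 0\<close>, it also admits actions that are
  never available in a state.
\<close>

definition wf_policy ::
  "('s, 'n::finite, 'k::finite) markov_game \<Rightarrow> ('s, 'n, 'k, 'm::finite) policy \<Rightarrow> bool" where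
  "wf_policy G \<pi> \<longleftrightarrow>
     (\<forall>n. (\<lambda>(\<theta>, s, a). \<pi> n \<theta> s a) \<in> borel_measurable (borel \<Otimes>\<^sub>M (states G \<Otimes>\<^sub>M actions G))) \<and>
     (\<forall>n. (\<lambda>(\<theta>, s). policy_law G \<pi> n \<theta> s) \<in> borel \<Otimes>\<^sub>M states G \<rightarrow>\<^sub>M prob_algebra (actions G)) \<and>
     (\<forall>n \<theta>. \<forall>s\<in>space (states G). \<forall>a\<in>space (actions G).
        0 \<le> \<pi> n \<theta> s a \<and>
        (\<lambda>\<theta>'. \<pi> n \<theta>' s a) differentiable (at \<theta>) \<and>
        (\<lambda>\<theta>'. ln (\<pi> n \<theta>' s a)) differentiable (at \<theta>))"

text \<open>\<open>score own \<pi> i n \<theta> s a\<close> is \<open>\<nabla>\<^sub>i log \<pi>\<^sub>n\<^sub>,\<^sub>\<theta>(a|s)\<close>.\<close>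

definition score ::
  "('m \<Rightarrow> 'n) \<Rightarrow> ('s, 'n, 'k, 'm::finite) policy \<Rightarrow> 'n \<Rightarrow> 'n \<Rightarrow> real^'m \<Rightarrow> 's \<Rightarrow> real^'k \<Rightarrow> real^'m" where
  "score own \<pi> i n \<theta> s a = block_grad own i (\<lambda>\<theta>'. ln (\<pi> n \<theta>' s a)) \<theta>"

text \<open>The probability measure on joint actions whose density is the product of the policies.\<close>

definition joint_policy_law ::
  "('s, 'n::finite, 'k::finite) markov_game \<Rightarrow> ('s, 'n, 'k, 'm::finite) policy \<Rightarrow>
   real^'m \<Rightarrow> 's \<Rightarrow> ('n \<Rightarrow> real^'k) measure" where
  "joint_policy_law G \<pi> \<theta> s = PiM UNIV (\<lambda>n. policy_law G \<pi> n \<theta> s)"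

definition act ::
  "('s, 'n::finite, 'k::finite) markov_game \<Rightarrow> ('s, 'n, 'k, 'm::finite) policy \<Rightarrow>
   real^'m \<Rightarrow> 's \<Rightarrow> ('s \<times> ('n \<Rightarrow> real^'k)) measure" where
  "act G \<pi> \<theta> s = distr (joint_policy_law G \<pi> \<theta> s) (state_actions G) (\<lambda>a. (s, a))"

text \<open>
  \<open>chain G \<pi> \<theta> \<mu> T\<close> is the law of the trajectory \<open>(s\<^sub>0, a\<^sub>0), \<dots>, (s\<^sub>T, a\<^sub>T)\<close> under the
  joint policy, when \<open>(s\<^sub>0, a\<^sub>0)\<close> has law \<open>\<mu>\<close>.
\<close>

primrec chain ::
  "('s, 'n::finite, 'k::finite) markov_game \<Rightarrow> ('s, 'n, 'k, 'm::finite) policy \<Rightarrow> real^'m \<Rightarrow>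
   ('s \<times> ('n \<Rightarrow> real^'k)) measure \<Rightarrow> nat \<Rightarrow> (nat \<Rightarrow> 's \<times> ('n \<Rightarrow> real^'k)) measure" where
  "chain G \<pi> \<theta> \<mu> 0 = distr \<mu> (PiM {..0} (\<lambda>_. state_actions G)) (\<lambda>x. \<lambda>t\<in>{..0}. x)"
| "chain G \<pi> \<theta> \<mu> (Suc T) =
     chain G \<pi> \<theta> \<mu> T \<bind> (\<lambda>w.
       distr (trans G (w T) \<bind> act G \<pi> \<theta>) (PiM {..Suc T} (\<lambda>_. state_actions G))
         (\<lambda>x. w(Suc T := x)))"

text \<open>
  Laws of the sum of \<open>\<gamma>\<^bsup>k/2\<^esup> r\<^sub>i\<close> up to a \<open>Geom(1 - \<gamma>\<^bsup>1/2\<^esup>)\<close> time along the chain: started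
  with initial law \<open>\<mu>\<close>, at the state-action pair \<open>x\<close>, and at the state \<open>s\<close>.
\<close>

definition return_law ::
  "('s, 'n::finite, 'k::finite) markov_game \<Rightarrow> ('s, 'n, 'k, 'm::finite) policy \<Rightarrow> 'n \<Rightarrow> real^'m \<Rightarrow>
   ('s \<times> ('n \<Rightarrow> real^'k)) measure \<Rightarrow> real measure" where
  "return_law G \<pi> i \<theta> \<mu> =
     measure_pmf (geometric_pmf (1 - discount G powr (1/2))) \<bind> (\<lambda>T.
       distr (chain G \<pi> \<theta> \<mu> T) borel
         (\<lambda>w. \<Sum>k\<le>T. discount G powr (real k / 2) * reward G i (w k)))"

definition Q_law ::
  "('s, 'n::finite, 'k::finite) markov_game \<Rightarrow> ('s, 'n, 'k, 'm::finite) policy \<Rightarrow> 'n \<Rightarrow> real^'m \<Rightarrow>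
   's \<times> ('n \<Rightarrow> real^'k) \<Rightarrow> real measure" where
  "Q_law G \<pi> i \<theta> x = return_law G \<pi> i \<theta> (return (state_actions G) x)"

definition V_law ::
  "('s, 'n::finite, 'k::finite) markov_game \<Rightarrow> ('s, 'n, 'k, 'm::finite) policy \<Rightarrow> 'n \<Rightarrow> real^'m \<Rightarrow>
   's \<Rightarrow> real measure" where
  "V_law G \<pi> i \<theta> s = return_law G \<pi> i \<theta> (act G \<pi> \<theta> s)"

datatype estimator_kind = Q_value | Advantage | Temporal_difference

fun reward_law ::
  "estimator_kind \<Rightarrow> ('s, 'n::finite, 'k::finite) markov_game \<Rightarrow> ('s, 'n, 'k, 'm::finite) policy \<Rightarrow>
   'n \<Rightarrow> real^'m \<Rightarrow> 's \<times> ('n \<Rightarrow> real^'k) \<Rightarrow> real measure" where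
  "reward_law Q_value G \<pi> i \<theta> (s, a) = Q_law G \<pi> i \<theta> (s, a)"
| "reward_law Advantage G \<pi> i \<theta> (s, a) =
     Q_law G \<pi> i \<theta> (s, a) \<bind> (\<lambda>q. distr (V_law G \<pi> i \<theta> s) borel (\<lambda>v. q - v))"
| "reward_law Temporal_difference G \<pi> i \<theta> (s, a) =
     (trans G (s, a) \<bind> V_law G \<pi> i \<theta>) \<bind> (\<lambda>v'.
       distr (V_law G \<pi> i \<theta> s) borel (\<lambda>v. reward G i (s, a) + discount G * v' - v))"

text \<open>The law of the gradient estimator of agent \<open>i\<close> at the joint parameter \<open>\<theta>\<close>.\<close>

definition estimator_law ::
  "estimator_kind \<Rightarrow> ('s, 'n::finite, 'k::finite) markov_game \<Rightarrow> ('m \<Rightarrow> 'n) \<Rightarrow>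
   ('s, 'n, 'k, 'm::finite) policy \<Rightarrow> 'n \<Rightarrow> real^'m \<Rightarrow> (real^'m) measure" where
  "estimator_law kind G own \<pi> i \<theta> =
     measure_pmf (geometric_pmf (1 - discount G)) \<bind> (\<lambda>T.
       chain G \<pi> \<theta> (act G \<pi> \<theta> (init_state G)) T \<bind> (\<lambda>w.
         case w T of (s, a) \<Rightarrow>
           distr (reward_law kind G \<pi> i \<theta> (s, a)) borel
             (\<lambda>R. (1 / (1 - discount G) * R) *\<^sub>R (\<Sum>n\<in>UNIV. score own \<pi> i n \<theta> s (a n)))))"

text \<open>\<open>K\<close> is a conditional distribution of \<open>X\<close> given the sub-\<open>\<sigma>\<close>-algebra \<open>F\<close> of \<open>M\<close>.\<close>

definition cond_law ::
  "'w measure \<Rightarrow> 'w measure \<Rightarrow> ('w \<Rightarrow> 'x) \<Rightarrow> 'x measure \<Rightarrow> ('w \<Rightarrow> 'x measure) \<Rightarrow> bool" where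
  "cond_law M F X N K \<longleftrightarrow>
     X \<in> M \<rightarrow>\<^sub>M N \<and> K \<in> F \<rightarrow>\<^sub>M prob_algebra N \<and>
     (\<forall>A\<in>sets F. \<forall>C\<in>sets N. emeasure M (A \<inter> X -` C) = (\<integral>\<^sup>+\<omega>\<in>A. emeasure (K \<omega>) C \<partial>M))"

text \<open>
  \<open>\<Theta> t\<close> is the joint parameter at time \<open>t\<close>.  \<open>\<Psi> t \<omega> $ i\<close> collects the beliefs of agent \<open>i\<close>:
  its coordinate \<open>m\<close> is the belief about coordinate \<open>m\<close> of the parameter of agent \<open>own m\<close>.
\<close>

definition local_view :: "('m \<Rightarrow> 'n) \<Rightarrow> 'n \<Rightarrow> real^'m \<Rightarrow> real^'m^'n \<Rightarrow> real^'m::finite" where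
  "local_view own i \<theta> \<psi> = (\<chi> m. if own m = i then \<theta> $ m else \<psi> $ i $ m)"

definition past ::
  "'w measure \<Rightarrow> (nat \<Rightarrow> 'w \<Rightarrow> real^'m::finite) \<Rightarrow> (nat \<Rightarrow> 'w \<Rightarrow> real^'m^'n::finite) \<Rightarrow> nat \<Rightarrow> 'w measure" where
  "past M \<Theta> \<Psi> t =
     vimage_algebra (space M) (\<lambda>\<omega>. \<lambda>s\<in>{..t}. (\<Theta> s \<omega>, \<Psi> s \<omega>)) (PiM {..t} (\<lambda>_. borel))"

text \<open>
  In the weight matrix \<open>W t j\<close>, the entry \<open>W t j $ i $ l\<close> is the weight \<open>w\<^sup>i\<^sub>j\<^sub>l\<^sub>,\<^sub>t\<close>.
  \<open>D t i\<close> is the estimate produced by agent \<open>i\<close> at time \<open>t\<close>.  Only its conditional law given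
  the past is prescribed; the dependence between the draws of different agents is left open.
\<close>

definition networked_play ::
  "(('s, 'n::finite, 'k::finite) markov_game) \<Rightarrow> ('m \<Rightarrow> 'n) \<Rightarrow> ('s, 'n, 'k, 'm::finite) policy \<Rightarrow>
   ('n \<Rightarrow> estimator_kind) \<Rightarrow> (nat \<Rightarrow> real) \<Rightarrow> (nat \<Rightarrow> 'n \<Rightarrow> real^'n^'n) \<Rightarrow> 'w measure \<Rightarrow>
   (nat \<Rightarrow> 'w \<Rightarrow> real^'m) \<Rightarrow> (nat \<Rightarrow> 'w \<Rightarrow> real^'m^'n) \<Rightarrow> (nat \<Rightarrow> 'n \<Rightarrow> 'w \<Rightarrow> real^'m) \<Rightarrow> bool" where
  "networked_play G own \<pi> kind \<alpha> W M \<Theta> \<Psi> D \<longleftrightarrow>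
     prob_space M \<and>
     (\<forall>t. \<Theta> t \<in> borel_measurable M \<and> \<Psi> t \<in> borel_measurable M) \<and>
     (\<forall>t i. cond_law M (past M \<Theta> \<Psi> t) (D (Suc t) i) borel
        (\<lambda>\<omega>. estimator_law (kind i) G own \<pi> i (local_view own i (\<Theta> t \<omega>) (\<Psi> t \<omega>)))) \<and>
     (\<forall>t i. \<forall>\<omega>\<in>space M.
        block own i (\<Theta> (Suc t) \<omega>) =
        block own i (\<Theta> t \<omega>) + \<alpha> (Suc t) *\<^sub>R block own i (D (Suc t) i \<omega>)) \<and>
     (\<forall>t j m. own m = j \<longrightarrow> (\<forall>\<omega>\<in>space M.
        (\<chi> i. \<Psi> (Suc t) \<omega> $ i $ m) =
        W (Suc t) j *v ((\<chi> i. \<Psi> t \<omega> $ i $ m) + (\<Theta> (Suc t) \<omega> $ m - \<Theta> t \<omega> $ m) *\<^sub>R axis j 1)))"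

definition limit_edges :: "(nat \<Rightarrow> ('n \<times> 'n) set) \<Rightarrow> ('n \<times> 'n) set" where
  "limit_edges E = {e. \<exists>\<^sub>\<infinity>t. e \<in> E t}"

end

theory Submission
  imports Defs
begin

text \<open>
  The row of agent \<open>j\<close> in \<open>W t j\<close> is a unit vector, so agent \<open>j\<close> always knows its own parameter and
  the belief error about a coordinate of \<open>\<theta>\<^sub>j\<close> vanishes at \<open>j\<close>.  The expected absolute errors \<open>f t i\<close>
  therefore satisfy \<open>f (t + 1) i \<le> (\<Sum>l. W\<^sub>i\<^sub>l * f t l) + b (t + 1)\<close> with \<open>f t j = 0\<close>, where \<open>b (t + 1)\<close>
  bounds the expected size of the parameter step.  Within a window of fixed length \<open>S\<close> every agent puts
  weight at least \<open>h ^ S\<close> on agent \<open>j\<close>, through a path of the limit graph, so the errors contract by the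
  factor \<open>1 - h ^ S\<close> over such a window; a recursion of this kind inherits the rate \<open>t\<^bsup>-\<beta>\<^esup>\<close> of its
  perturbation.  The perturbation has this rate because the gradient estimator is bounded in mean,
  uniformly in \<open>\<theta>\<close>: the discounted returns are bounded almost surely, and given the state the
  expected norm of each score is at most \<open>B\<close>.
\<close>

section \<open>Contraction of the consensus step\<close>

text \<open>Averaging alone never raises the maximal error beyond the accumulated perturbations. The
  strict gain comes from agent \<open>j\<close>, whose error is 0: each step across an edge of
  \<open>E\<close>, and each step spent waiting, passes on at least the fraction \<open>h\<close> of
  a gain, and after \<open>S\<close> steps the gain has reached every agent.\<close>

lemma consensus_contraction:
  fixes w :: "nat \<Rightarrow> 'n::finite \<Rightarrow> 'n \<Rightarrow> real" and f :: "nat \<Rightarrow> 'n \<Rightarrow> real" and b :: "nat \<Rightarrow> real"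
  assumes connected: "\<And>i j. (i, j) \<in> (limit_edges E)\<^sup>*"
    and period: "T > 0" "\<And>e t. e \<in> limit_edges E \<Longrightarrow> t \<ge> 1 \<Longrightarrow> e \<in> (\<Union>\<tau>\<in>{0..T - 1}. E (t + \<tau>))"
    and h: "0 < h" "h < 1"
    and w_nonneg: "\<And>t i l. t \<ge> 1 \<Longrightarrow> w t i l \<ge> 0"
    and w_ge: "\<And>t i l. t \<ge> 1 \<Longrightarrow> i \<noteq> j \<Longrightarrow> (i, l) \<in> E t \<or> l = i \<Longrightarrow> w t i l \<ge> h"
    and w_sum: "\<And>t i. t \<ge> 1 \<Longrightarrow> (\<Sum>l\<in>UNIV. w t i l) = 1"
    and step: "\<And>t i. f (Suc t) i \<le> (\<Sum>l\<in>UNIV. w (Suc t) i l * f t l) + b (Suc t)"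
    and source: "\<And>t. f t j = 0"
    and b: "\<And>t. b t \<ge> 0"
  obtains S where "S > 0"
    "\<And>t c i. c \<ge> 0 \<Longrightarrow> (\<And>l. f t l \<le> c) \<Longrightarrow> f (t + S) i \<le> (1 - h ^ S) * c + (\<Sum>s\<in>{t+1..t+S}. b s)"
proof -
  have "\<exists>n. (i, j) \<in> limit_edges E ^^ n" for i
    using connected[of i j] rtrancl_imp_relpow by blast
  then obtain d where d: "\<And>i. (i, j) \<in> limit_edges E ^^ d i" by metis
  \<comment> \<open>Each edge of a path to \<open>j\<close> occurs within any \<open>T\<close>
    consecutive steps, so \<open>d i * T\<close> steps suffice for agent \<open>i\<close>. The
    \<open>Suc\<close> keeps \<open>S\<close> positive even if all \<open>d i\<close> are 0.\<close>
  define S where "S = Suc (Max (range d)) * T"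
  have S: "d i * T \<le> S" for i
    unfolding S_def by (intro mult_right_mono le_SucI Max_ge) auto
  have "f (t + S) i \<le> (1 - h ^ S) * c + (\<Sum>s\<in>{t+1..t+S}. b s)"
    if c: "c \<ge> 0" and fc: "\<And>l. f t l \<le> c" for t c i
  proof -
    \<comment> \<open>This is the bound that averaging alone gives after \<open>k\<close> steps,
      proved as \<open>fA\<close> below.\<close>
    define A where "A k = c + (\<Sum>s\<in>{t+1..t+k}. b s)" for k
    have A_Suc: "A (Suc k) = A k + b (Suc (t + k))" for k by (simp add: A_def)
    have cA: "c \<le> A k" for k unfolding A_def using b by (simp add: sum_nonneg)
    have hk: "h ^ k * c \<le> A k" for k
      using cA[of k] h mult_right_mono[OF power_le_one[of h k] c] by simp
    have fA: "f (t + k) i \<le> A k" for k i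
    proof (induction k arbitrary: i)
      case 0 then show ?case using fc by (simp add: A_def)
    next
      case (Suc k)
      have "(\<Sum>l\<in>UNIV. w (Suc (t + k)) i l * f (t + k) l) \<le> (\<Sum>l\<in>UNIV. w (Suc (t + k)) i l * A k)"
        by (intro sum_mono mult_left_mono Suc w_nonneg) auto
      also have "\<dots> = A k" by (simp add: w_sum flip: sum_distrib_right)
      finally show ?case using step[of "t + k" i] by (simp add: A_Suc)
    qed
    \<comment> \<open>A good agent lies below the bound \<open>A k\<close> by what is left of the
      gain \<open>c\<close> of agent \<open>j\<close> after \<open>k\<close> multiplications by
      \<open>h\<close>.\<close>
    define good where "good k i \<longleftrightarrow> f (t + k) i \<le> A k - h ^ k * c" for k i
    have good_j: "good k j" for k
      using hk[of k] by (simp add: good_def source)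
    \<comment> \<open>The gain of \<open>l\<close> enters the average of \<open>i\<close> with
      weight at least \<open>h\<close>, and all other errors are bounded by \<open>A k\<close>. The
      alternative \<open>l = i\<close> uses the self-weight: a good agent stays good while it
      waits.\<close>
    have good_step: "good (Suc k) i" if g: "good k l" and e: "(i, l) \<in> E (Suc (t + k)) \<or> l = i" for k i l
    proof (cases "i = j")
      case False
      let ?w = "w (Suc (t + k)) i"
      have "?w m * f (t + k) m \<le> ?w m * A k - (if m = l then ?w l * (h ^ k * c) else 0)" for m
        using g fA[of k m] mult_left_mono[of "f (t+k) m" "A k - (if m = l then h^k*c else 0)" "?w m"]
          w_nonneg[of "Suc (t+k)" i m]
        by (auto simp: good_def algebra_simps)
      then have "(\<Sum>m\<in>UNIV. ?w m * f (t + k) m) \<le> (\<Sum>m\<in>UNIV. ?w m * A k - (if m = l then ?w l * (h ^ k * c) else 0))"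
        by (intro sum_mono)
      also have "\<dots> = A k - ?w l * (h ^ k * c)"
        by (simp add: sum_subtractf w_sum flip: sum_distrib_right)
      also have "\<dots> \<le> A k - h * (h ^ k * c)"
        using w_ge[of "Suc (t+k)" i l] False e h c by (intro diff_left_mono mult_right_mono) auto
      finally show ?thesis using step[of "t + k" i] by (simp add: A_Suc good_def mult.assoc)
    qed (use good_j in simp)
    have good_mono: "good k' i" if "good k i" "k \<le> k'" for k k' i
      using that(2,1) by (induction rule: dec_induct) (auto intro: good_step)
    \<comment> \<open>Induction on the length of a path from \<open>i\<close> to \<open>j\<close>.
      The next agent \<open>l\<close> is good at step \<open>n * T\<close>, waits
      \<open>\<tau>\<close> steps for the edge \<open>(i, l)\<close>, and then \<open>i\<close>
      waits for the rest of the period. The graph used in the step from \<open>k\<close> to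
      \<open>k + 1\<close> has index \<open>Suc (t + k)\<close>, hence the shift by one in the use
      of \<open>period\<close>.\<close>
    have "good (n * T) i" if "(i, j) \<in> limit_edges E ^^ n" for n i
      using that
    proof (induction n arbitrary: i)
      case 0 then show ?case using good_j by simp
    next
      case (Suc n)
      then obtain l where l: "(i, l) \<in> limit_edges E" "(l, j) \<in> limit_edges E ^^ n"
        by (meson relpow_Suc_D2)
      obtain \<tau> where \<tau>: "\<tau> \<le> T - 1" "(i, l) \<in> E (Suc (t + n * T + \<tau>))"
        using period(2)[OF l(1), of "Suc (t + n * T)"] by auto
      have "good (n * T + \<tau>) l" by (rule good_mono[OF Suc.IH[OF l(2)]]) simp
      then have "good (Suc (n * T + \<tau>)) i" by (rule good_step) (use \<tau> in \<open>simp add: add.assoc\<close>)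
      then show ?case by (rule good_mono) (use \<tau>(1) period(1) in simp)
    qed
    then have "good S i" using good_mono d S by blast
    then show ?thesis by (simp add: good_def A_def algebra_simps)
  qed
  moreover have "S > 0" using period(1) by (simp add: S_def)
  ultimately show thesis using that by blast
qed

section \<open>From contraction over windows to the rate t^(-\<beta>)\<close>

text \<open>Over a window of fixed length the power t^(-\<beta>) shrinks by a factor that tends to
  1, so it eventually shrinks less than the errors contract. Induction in steps of length
  \<open>S\<close> then preserves a multiple of the power. The base \<open>Suc t\<close> keeps the
  bound meaningful at \<open>t = 0\<close>, where \<open>0 powr (-\<beta>)\<close> is 0.\<close>

lemma contraction_powr_rate:
  fixes f :: "nat \<Rightarrow> 'i::finite \<Rightarrow> real"
  assumes S: "S > 0" and \<rho>: "0 \<le> \<rho>" "\<rho> < 1" and \<beta>: "\<beta> > 0" and K: "K \<ge> 0"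
    and contr: "\<And>t c i. c \<ge> 0 \<Longrightarrow> (\<And>l. f t l \<le> c) \<Longrightarrow> f (t + S) i \<le> \<rho> * c + K * real (Suc t) powr (-\<beta>)"
  obtains A where "A \<ge> 0" "\<And>t i. f t i \<le> A * real (Suc t) powr (-\<beta>)"
proof -
  \<comment> \<open>Any number strictly between \<open>\<rho>\<close> and 1 would do: the gap above
    \<open>\<rho>\<close> absorbs the perturbation, the gap below 1 absorbs the decay of the
    power.\<close>
  define r where "r = (1 + \<rho>) / 2"
  have r: "\<rho> < r" "r < 1" "r > 0" using \<rho> by (auto simp: r_def)
  have "(\<lambda>t. (real (Suc (t + S)) / real (Suc t)) powr (-\<beta>)) \<longlonglongrightarrow> 1 powr (-\<beta>)"
  proof (rule tendsto_powr)
    have "(\<lambda>t. 1 + real S * inverse (real (Suc t))) \<longlonglongrightarrow> 1 + real S * 0"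
      by (intro tendsto_intros LIMSEQ_inverse_real_of_nat)
    then show "(\<lambda>t. real (Suc (t + S)) / real (Suc t)) \<longlonglongrightarrow> 1"
      by (simp add: field_simps)
  qed auto
  then have "\<forall>\<^sub>F t in sequentially. (real (Suc (t + S)) / real (Suc t)) powr (-\<beta>) > r"
    using r(2) by (intro order_tendstoD(1)) auto
  then obtain t0 where t0: "\<And>t. t \<ge> t0 \<Longrightarrow> (real (Suc (t + S)) / real (Suc t)) powr (-\<beta>) > r"
    by (auto simp: eventually_sequentially)
  have ratio: "r * real (Suc t) powr (-\<beta>) \<le> real (Suc (t + S)) powr (-\<beta>)" if "t \<ge> t0" for t
  proof -
    have "r \<le> real (Suc (t + S)) powr (-\<beta>) / real (Suc t) powr (-\<beta>)"
      using t0[OF that] by (simp add: powr_divide)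
    then show ?thesis
      using powr_gt_zero[of "real (Suc t)" "-\<beta>"] by (simp only: pos_le_divide_eq[symmetric])
  qed
  \<comment> \<open>\<open>Q\<close> settles the finitely many times below \<open>t0 + S\<close>,
    from which one cannot step back to a time at least \<open>t0\<close>. The other entry of the
    maximum in \<open>A\<close> yields \<open>\<rho> * A + K \<le> r * A\<close>, which closes the
    induction.\<close>
  define Q where "Q = Max (insert 0 ((\<lambda>(t, i). f t i * real (Suc t) powr \<beta>) ` ({..<t0 + S} \<times> UNIV)))"
  define A where "A = max Q (K / (r - \<rho>))"
  have A: "A \<ge> 0" "K \<le> A * (r - \<rho>)"
  proof -
    show "A \<ge> 0" using r K by (simp add: A_def le_max_iff_disj)
    have "K / (r - \<rho>) \<le> A" by (simp add: A_def)
    then show "K \<le> A * (r - \<rho>)" using r by (simp add: field_simps)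
  qed
  have "f t i \<le> A * real (Suc t) powr (-\<beta>)" for t i
  proof (induction t arbitrary: i rule: less_induct)
    case (less t)
    show ?case
    proof (cases "t < t0 + S")
      case True
      have "f t i * real (Suc t) powr \<beta> \<le> Q"
        unfolding Q_def using True by (intro Max_ge) auto
      also have "\<dots> \<le> A" by (simp add: A_def)
      finally show ?thesis by (simp add: powr_minus field_simps)
    next
      case False
      define u where "u = t - S"
      have u: "t = u + S" "u \<ge> t0" "u < t" using False S by (auto simp: u_def)
      let ?p = "real (Suc u) powr (-\<beta>)"
      have "f t i \<le> \<rho> * (A * ?p) + K * ?p"
        unfolding u(1) using less[OF u(3)] A by (intro contr) auto
      also have "\<dots> \<le> \<rho> * (A * ?p) + (A * (r - \<rho>)) * ?p"
        using A by (intro add_left_mono mult_right_mono) auto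
      also have "\<dots> = A * (r * ?p)" by (simp add: algebra_simps)
      also have "\<dots> \<le> A * real (Suc t) powr (-\<beta>)"
        unfolding u(1) using A ratio[OF u(2)] by (intro mult_left_mono) auto
      finally show ?thesis .
    qed
  qed
  with A show thesis using that by blast
qed

text \<open>Since t^(-\<beta>) decreases, the \<open>S\<close> perturbations in the window after
  \<open>t\<close> add up to at most \<open>S * K\<close> times the power at \<open>t + 1\<close>.
  The window contraction thus has the form required for the power rate, with
  \<open>\<rho> = 1 - h ^ S\<close>.\<close>

lemma consensus_rate:
  fixes w :: "nat \<Rightarrow> 'n::finite \<Rightarrow> 'n \<Rightarrow> real" and f :: "nat \<Rightarrow> 'n \<Rightarrow> real" and b :: "nat \<Rightarrow> real"
  assumes connected: "\<And>i j. (i, j) \<in> (limit_edges E)\<^sup>*"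
    and period: "T > 0" "\<And>e t. e \<in> limit_edges E \<Longrightarrow> t \<ge> 1 \<Longrightarrow> e \<in> (\<Union>\<tau>\<in>{0..T - 1}. E (t + \<tau>))"
    and h: "0 < h" "h < 1"
    and w_nonneg: "\<And>t i l. t \<ge> 1 \<Longrightarrow> w t i l \<ge> 0"
    and w_ge: "\<And>t i l. t \<ge> 1 \<Longrightarrow> i \<noteq> j \<Longrightarrow> (i, l) \<in> E t \<or> l = i \<Longrightarrow> w t i l \<ge> h"
    and w_sum: "\<And>t i. t \<ge> 1 \<Longrightarrow> (\<Sum>l\<in>UNIV. w t i l) = 1"
    and step: "\<And>t i. f (Suc t) i \<le> (\<Sum>l\<in>UNIV. w (Suc t) i l * f t l) + b (Suc t)"
    and source: "\<And>t. f t j = 0"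
    and b: "\<And>t. b t \<ge> 0" "\<And>t. t \<ge> 1 \<Longrightarrow> b t \<le> K * real t powr (-\<beta>)"
    and K: "K \<ge> 0" and \<beta>: "\<beta> > 0"
  obtains A where "A \<ge> 0" "\<And>t i. f t i \<le> A * real (Suc t) powr (-\<beta>)"
proof -
  obtain S where S: "S > 0" and contr:
    "\<And>t c i. c \<ge> 0 \<Longrightarrow> (\<And>l. f t l \<le> c) \<Longrightarrow> f (t + S) i \<le> (1 - h ^ S) * c + (\<Sum>s\<in>{t+1..t+S}. b s)"
    using consensus_contraction[where w=w and f=f and b=b and j=j, OF connected period h w_nonneg w_ge w_sum step source b(1)] by blast
  show thesis
  proof (rule contraction_powr_rate[OF S])
    show "0 \<le> 1 - h ^ S" "1 - h ^ S < 1" using h by (auto simp: power_le_one)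
    show "real S * K \<ge> 0" using K by simp
    show "\<beta> > 0" by fact
    fix t c i assume c: "c \<ge> 0" "\<And>l. f t l \<le> c"
    have "(\<Sum>s\<in>{t+1..t+S}. b s) \<le> (\<Sum>s\<in>{t+1..t+S}. K * real (Suc t) powr (-\<beta>))"
    proof (rule sum_mono)
      fix s assume s: "s \<in> {t+1..t+S}"
      then have "b s \<le> K * real s powr (-\<beta>)" by (intro b(2)) auto
      also have "\<dots> \<le> K * real (Suc t) powr (-\<beta>)"
        using s K \<beta> by (intro mult_left_mono powr_mono2') auto
      finally show "b s \<le> K * real (Suc t) powr (-\<beta>)" .
    qed
    with contr[OF c, of i] show "f (t + S) i \<le> (1 - h ^ S) * c + real S * K * real (Suc t) powr (-\<beta>)"
      by simp
  qed (fact that)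
qed

text \<open>The finitely many indices before the asymptotic bound sets in are absorbed by the
  constant. Index 0 is excluded because \<open>0 powr p\<close> is 0.\<close>

lemma bigo_powr_bound:
  fixes a :: "nat \<Rightarrow> real"
  assumes "a \<in> O(\<lambda>t. real t powr p)"
  obtains K where "K \<ge> 0" "\<And>t. t \<ge> 1 \<Longrightarrow> \<bar>a t\<bar> \<le> K * real t powr p"
proof -
  obtain c where c: "c > 0" "eventually (\<lambda>t. \<bar>a t\<bar> \<le> c * real t powr p) at_top"
    using assms by (elim landau_o.bigE) auto
  then obtain t0 where t0: "\<And>t. t \<ge> t0 \<Longrightarrow> \<bar>a t\<bar> \<le> c * real t powr p"
    by (auto simp: eventually_at_top_linorder)
  define K where "K = Max (insert c ((\<lambda>t. \<bar>a t\<bar> / real t powr p) ` {1..<t0}))"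
  have cK: "c \<le> K" unfolding K_def by (intro Max_ge) auto
  have "\<bar>a t\<bar> \<le> K * real t powr p" if t: "t \<ge> 1" for t
  proof (cases "t \<ge> t0")
    case True
    then show ?thesis using t0[of t] cK by (meson mult_right_mono order_trans powr_ge_zero)
  next
    case False
    then have "\<bar>a t\<bar> / real t powr p \<le> K" using t unfolding K_def by (intro Max_ge) auto
    then show ?thesis using t by (simp add: divide_le_eq)
  qed
  with cK c(1) that show thesis by (meson less_imp_le order_trans)
qed

section \<open>Kernels of the Markov game\<close>

lemma nn_integral_bind_prob_algebra:
  assumes f: "f \<in> borel_measurable B" and N: "N \<in> A \<rightarrow>\<^sub>M prob_algebra B"
    and M: "M \<in> space (prob_algebra A)"
  shows "(\<integral>\<^sup>+y. f y \<partial>(M \<bind> N)) = (\<integral>\<^sup>+x. \<integral>\<^sup>+y. f y \<partial>N x \<partial>M)"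
proof (rule nn_integral_bind[OF f])
  have "sets M = sets A" using M by (simp add: space_prob_algebra)
  then show "N \<in> M \<rightarrow>\<^sub>M subprob_algebra B"
    using measurable_prob_algebraD[OF N] by (simp cong: measurable_cong_sets)
qed

lemma nn_integral_le_const_prob_algebra:
  fixes c :: ennreal
  assumes M: "M \<in> space (prob_algebra A)" and le: "\<And>x. x \<in> space A \<Longrightarrow> f x \<le> c"
  shows "(\<integral>\<^sup>+x. f x \<partial>M) \<le> c"
proof -
  have M': "sets M = sets A" "prob_space M" using M by (auto simp: space_prob_algebra)
  interpret prob_space M by fact
  have "(\<integral>\<^sup>+x. f x \<partial>M) \<le> (\<integral>\<^sup>+x. c \<partial>M)"
    by (intro nn_integral_mono le) (simp add: sets_eq_imp_space_eq[OF M'(1)])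
  then show ?thesis by (simp add: emeasure_space_1)
qed

text \<open>Serves to remove random times, states and actions one at a time from the moment bounds:
  a bound common to all branches survives any random choice of the branch.\<close>

lemma nn_integral_bind_le:
  fixes c :: ennreal
  assumes f: "f \<in> borel_measurable B" and N: "N \<in> A \<rightarrow>\<^sub>M prob_algebra B"
    and M: "M \<in> space (prob_algebra A)"
    and le: "\<And>x. x \<in> space A \<Longrightarrow> (\<integral>\<^sup>+y. f y \<partial>N x) \<le> c"
  shows "(\<integral>\<^sup>+y. f y \<partial>(M \<bind> N)) \<le> c"
  unfolding nn_integral_bind_prob_algebra[OF f N M]
  by (rule nn_integral_le_const_prob_algebra[OF M le])

lemma nn_integral_distr_prob_algebra:
  assumes M: "M \<in> space (prob_algebra A)" and g: "g \<in> A \<rightarrow>\<^sub>M B" and f: "f \<in> borel_measurable B"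
  shows "(\<integral>\<^sup>+y. f y \<partial>distr M B g) = (\<integral>\<^sup>+x. f (g x) \<partial>M)"
proof (rule nn_integral_distr)
  show "f \<in> borel_measurable (distr M B g)" using f by simp
  have "sets M = sets A" using M by (simp add: space_prob_algebra)
  then show "g \<in> M \<rightarrow>\<^sub>M B" using g by (simp cong: measurable_cong_sets)
qed

text \<open>Boxes form an intersection-stable generator of the product \<sigma>-algebra, and the
  mass of a box is a finite product of functions measurable in \<open>x\<close>.\<close>

lemma measurable_PiM_prob_algebra:
  fixes N :: "'i::finite \<Rightarrow> 'b measure"
  assumes K: "\<And>i. K i \<in> A \<rightarrow>\<^sub>M prob_algebra (N i)"
  shows "(\<lambda>x. PiM UNIV (\<lambda>i. K i x)) \<in> A \<rightarrow>\<^sub>M prob_algebra (PiM UNIV N)"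
proof (rule measurable_prob_algebra_generated[OF sets_PiM Int_stable_prod_algebra prod_algebra_sets_into_space])
  fix x assume x: "x \<in> space A"
  have Kx: "sets (K i x) = sets (N i)" "prob_space (K i x)" for i
    using measurable_space[OF K x] by (auto simp: space_prob_algebra)
  show "prob_space (PiM UNIV (\<lambda>i. K i x))" by (intro prob_space_PiM Kx)
  show "sets (PiM UNIV (\<lambda>i. K i x)) = sets (PiM UNIV N)" by (intro sets_PiM_cong Kx refl)
next
  fix X assume "X \<in> prod_algebra UNIV N"
  then obtain E where E: "X = Pi\<^sub>E UNIV E" "\<And>i. E i \<in> sets (N i)"
    by (auto simp: prod_algebra_eq_finite)
  have "(\<lambda>x. \<Prod>i\<in>UNIV. emeasure (K i x) (E i)) \<in> borel_measurable A"
    by (intro borel_measurable_prod_ennreal measurable_compose[OF measurable_prob_algebraD[OF K]]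
        measurable_emeasure_subprob_algebra E)
  also have "?this \<longleftrightarrow> (\<lambda>x. emeasure (PiM UNIV (\<lambda>i. K i x)) X) \<in> borel_measurable A"
  proof (rule measurable_cong)
    fix x assume x: "x \<in> space A"
    have Kx: "sets (K i x) = sets (N i)" "prob_space (K i x)" for i
      using measurable_space[OF K x] by (auto simp: space_prob_algebra)
    have "emeasure (PiM UNIV (\<lambda>i. K i x)) (prod_emb UNIV (\<lambda>i. K i x) UNIV (Pi\<^sub>E UNIV E)) =
        (\<Prod>i\<in>UNIV. emeasure (K i x) (E i))"
      by (intro emeasure_PiM_emb Kx) (auto simp: Kx E)
    moreover have "prod_emb UNIV (\<lambda>i. K i x) UNIV (Pi\<^sub>E UNIV E) = X"
      unfolding E(1) by (intro prod_emb_PiE_same_index sets.sets_into_space) (simp add: Kx E)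
    ultimately show "(\<Prod>i\<in>UNIV. emeasure (K i x) (E i)) = emeasure (PiM UNIV (\<lambda>i. K i x)) X"
      by simp
  qed
  finally show "(\<lambda>x. emeasure (PiM UNIV (\<lambda>i. K i x)) X) \<in> borel_measurable A" .
qed

section \<open>Measurability of the laws along the chain\<close>

locale markov_policy =
  fixes G :: "('s, 'n::finite, 'k::finite) markov_game" and \<pi> :: "('s, 'n, 'k, 'm::finite) policy"
  assumes game: "wf_game G" and policy: "wf_policy G \<pi>"
begin

abbreviation "\<gamma> \<equiv> discount G"
abbreviation "SA \<equiv> state_actions G"
abbreviation "paths (T::nat) \<equiv> PiM {..T} (\<lambda>_. SA)"

lemma discount: "0 < \<gamma>" "\<gamma> < 1"
  using game by (auto simp: wf_game_def)

lemma init_state: "init_state G \<in> space (states G)"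
  using game by (auto simp: wf_game_def)

lemma measurable_trans[measurable]: "trans G \<in> SA \<rightarrow>\<^sub>M prob_algebra (states G)"
  using game by (auto simp: wf_game_def)

lemma measurable_reward[measurable]: "reward G i \<in> borel_measurable SA"
  using game by (auto simp: wf_game_def)

lemma measurable_policy_law[measurable]:
  "policy_law G \<pi> n \<theta> \<in> states G \<rightarrow>\<^sub>M prob_algebra (actions G)"
proof -
  have "(\<lambda>(\<theta>, s). policy_law G \<pi> n \<theta> s) \<in> borel \<Otimes>\<^sub>M states G \<rightarrow>\<^sub>M prob_algebra (actions G)"
    using policy by (auto simp: wf_policy_def)
  from measurable_compose[OF measurable_Pair1' this, of \<theta>] show ?thesis by simp
qed

lemma measurable_joint_policy_law[measurable]:
  "joint_policy_law G \<pi> \<theta> \<in> states G \<rightarrow>\<^sub>M prob_algebra (joint_actions G)"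
  unfolding joint_policy_law_def joint_actions_def
  by (intro measurable_PiM_prob_algebra measurable_policy_law)

lemma measurable_Pair_state_actions[measurable]:
  "(\<lambda>(s, a). (s, a)) \<in> states G \<Otimes>\<^sub>M joint_actions G \<rightarrow>\<^sub>M SA"
  by (simp add: state_actions_def)

lemma measurable_act[measurable]: "act G \<pi> \<theta> \<in> states G \<rightarrow>\<^sub>M prob_algebra SA"
  unfolding act_def by measurable

lemma measurable_trans_act:
  "(\<lambda>x. trans G x \<bind> act G \<pi> \<theta>) \<in> SA \<rightarrow>\<^sub>M prob_algebra SA"
  by (rule measurable_bind_prob_space) measurable

text \<open>Makes the recursive step of \<open>chain\<close> a kernel between path spaces of
  consecutive lengths, so that \<open>measurable_chain\<close> follows by induction.\<close>

lemma measurable_extend_path: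
  "(\<lambda>w. distr (trans G (w T) \<bind> act G \<pi> \<theta>) (paths (Suc T)) (\<lambda>x. w(Suc T := x))) \<in>
     paths T \<rightarrow>\<^sub>M prob_algebra (paths (Suc T))"
proof (rule measurable_distr_prob_space2)
  show "(\<lambda>w. trans G (w T) \<bind> act G \<pi> \<theta>) \<in> paths T \<rightarrow>\<^sub>M prob_algebra SA"
    by (rule measurable_compose[OF _ measurable_trans_act]) (auto intro: measurable_component_singleton)
  show "(\<lambda>(w, x). w(Suc T := x)) \<in> paths T \<Otimes>\<^sub>M SA \<rightarrow>\<^sub>M paths (Suc T)"
    using measurable_add_dim[of "Suc T" "{..T}" "\<lambda>_. SA"] by (simp add: atMost_Suc)
qed

lemma measurable_chain[measurable]:
  "(\<lambda>\<mu>. chain G \<pi> \<theta> \<mu> T) \<in> prob_algebra SA \<rightarrow>\<^sub>M prob_algebra (paths T)"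
proof (induction T)
  case 0
  show ?case unfolding chain.simps
    by (intro measurable_distr_prob_space measurable_restrict) auto
next
  case (Suc T)
  show ?case unfolding chain.simps
    by (rule measurable_bind_prob_space[OF Suc measurable_extend_path])
qed

lemma component_paths: "k \<le> T \<Longrightarrow> (\<lambda>w. w k) \<in> paths T \<rightarrow>\<^sub>M SA"
  by (intro measurable_component_singleton) auto

lemma measurable_discounted_return:
  "(\<lambda>w. \<Sum>k\<le>T. \<gamma> powr (real k / 2) * reward G i (w k)) \<in> borel_measurable (paths T)"
  by (intro borel_measurable_sum borel_measurable_times measurable_const
      measurable_compose[OF component_paths measurable_reward]) auto

lemma measurable_return_law[measurable]:
  "return_law G \<pi> i \<theta> \<in> prob_algebra SA \<rightarrow>\<^sub>M prob_algebra borel"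
  unfolding return_law_def
proof (rule measurable_bind_prob_space2[where N="count_space UNIV"])
  let ?g = "\<lambda>\<mu> T. distr (chain G \<pi> \<theta> \<mu> T) borel (\<lambda>w. \<Sum>k\<le>T. \<gamma> powr (real k / 2) * reward G i (w k))"
  show "(\<lambda>\<mu>. measure_pmf (geometric_pmf (1 - \<gamma> powr (1 / 2)))) \<in> prob_algebra SA \<rightarrow>\<^sub>M prob_algebra (count_space UNIV)"
    by (intro measurable_const) (auto simp: space_prob_algebra measure_pmf.prob_space_axioms)
  have "(\<lambda>\<mu>. ?g \<mu> T) \<in> prob_algebra SA \<rightarrow>\<^sub>M prob_algebra borel" for T
    by (rule measurable_compose[OF measurable_chain measurable_distr_prob_space[OF measurable_discounted_return]])
  \<comment> \<open>The time ranges over a countable set, so joint measurability reduces to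
    measurability in \<open>\<mu>\<close> for each fixed \<open>T\<close>.\<close>
  then show "(\<lambda>(\<mu>, T). ?g \<mu> T) \<in> prob_algebra SA \<Otimes>\<^sub>M count_space UNIV \<rightarrow>\<^sub>M prob_algebra borel"
    by (simp add: measurable_split_conv
        measurable_compose_countable'[where I=UNIV and g=snd and f="\<lambda>T x. ?g (fst x) T", OF measurable_compose[OF measurable_fst]])
qed

lemma measurable_Q_law[measurable]: "Q_law G \<pi> i \<theta> \<in> SA \<rightarrow>\<^sub>M prob_algebra borel"
  unfolding Q_law_def by measurable

lemma measurable_V_law[measurable]: "V_law G \<pi> i \<theta> \<in> states G \<rightarrow>\<^sub>M prob_algebra borel"
  unfolding V_law_def by measurable

lemma measurable_fst_state_actions[measurable]: "fst \<in> SA \<rightarrow>\<^sub>M states G"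
  by (simp add: state_actions_def)

lemma measurable_snd_state_actions[measurable]: "snd \<in> SA \<rightarrow>\<^sub>M joint_actions G"
  by (simp add: state_actions_def)

lemma measurable_action[measurable]: "(\<lambda>x. snd x n) \<in> SA \<rightarrow>\<^sub>M actions G"
  by (rule measurable_compose[OF measurable_snd_state_actions])
    (simp add: joint_actions_def measurable_component_singleton)

text \<open>The defining equations match on an explicit pair; written as functions of
  \<open>x\<close> with \<open>fst x\<close>, the three laws are open to the measurability
  prover.\<close>

lemma reward_law_eq:
  "reward_law kd G \<pi> i \<theta> = (case kd of
      Q_value \<Rightarrow> Q_law G \<pi> i \<theta>
    | Advantage \<Rightarrow> (\<lambda>x. Q_law G \<pi> i \<theta> x \<bind> (\<lambda>q. distr (V_law G \<pi> i \<theta> (fst x)) borel (\<lambda>v. q - v)))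
    | Temporal_difference \<Rightarrow> (\<lambda>x. (trans G x \<bind> V_law G \<pi> i \<theta>) \<bind> (\<lambda>v'.
       distr (V_law G \<pi> i \<theta> (fst x)) borel (\<lambda>v. reward G i x + \<gamma> * v' - v))))"
  by (cases kd) (auto simp: fun_eq_iff)

lemma measurable_reward_law[measurable]: "reward_law kd G \<pi> i \<theta> \<in> SA \<rightarrow>\<^sub>M prob_algebra borel"
  unfolding reward_law_eq by (cases kd) (simp_all, measurable)


text \<open>The last pair of the trajectory either has the initial law or arises by drawing an
  action in the state just reached. A bound uniform in that state therefore applies at any time, and
  a case distinction on \<open>T\<close> replaces an induction.\<close>

lemma nn_integral_chain_last_le:
  fixes c :: ennreal
  assumes f: "f \<in> borel_measurable SA" and \<mu>: "\<mu> \<in> space (prob_algebra SA)"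
    and le: "(\<integral>\<^sup>+x. f x \<partial>\<mu>) \<le> c"
    and act_le: "\<And>s. s \<in> space (states G) \<Longrightarrow> (\<integral>\<^sup>+x. f x \<partial>act G \<pi> \<theta> s) \<le> c"
  shows "(\<integral>\<^sup>+w. f (w T) \<partial>chain G \<pi> \<theta> \<mu> T) \<le> c"
proof (cases T)
  case 0
  have "(\<lambda>x. \<lambda>t\<in>{..0}. x) \<in> SA \<rightarrow>\<^sub>M paths 0" by (intro measurable_restrict) auto
  then show ?thesis unfolding 0 chain.simps
    by (subst nn_integral_distr_prob_algebra[OF \<mu> _ measurable_compose[OF component_paths f]])
      (use le in auto)
next
  case (Suc n)
  have f': "(\<lambda>w. f (w (Suc n))) \<in> borel_measurable (paths (Suc n))"
    by (rule measurable_compose[OF component_paths f]) simp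
  have chain: "chain G \<pi> \<theta> \<mu> n \<in> space (prob_algebra (paths n))"
    by (rule measurable_space[OF measurable_chain \<mu>])
  show ?thesis unfolding Suc chain.simps
  proof (rule nn_integral_bind_le[OF f' measurable_extend_path chain])
    fix w assume w: "w \<in> space (paths n)"
    then have wn: "w n \<in> space SA" using measurable_space[OF component_paths[of n n]] by simp
    have ta: "trans G (w n) \<bind> act G \<pi> \<theta> \<in> space (prob_algebra SA)"
      by (rule measurable_space[OF measurable_trans_act wn])
    have upd: "(\<lambda>x. w(Suc n := x)) \<in> SA \<rightarrow>\<^sub>M paths (Suc n)"
      by (rule measurable_fun_upd[where J="{..n}"]) (use w in auto)
    have "(\<integral>\<^sup>+x. f x \<partial>(trans G (w n) \<bind> act G \<pi> \<theta>)) \<le> c"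
      by (rule nn_integral_bind_le[OF f measurable_act measurable_space[OF measurable_trans wn] act_le])
    then show "(\<integral>\<^sup>+w. f (w (Suc n)) \<partial>distr (trans G (w n) \<bind> act G \<pi> \<theta>) (paths (Suc n)) (\<lambda>x. w(Suc n := x))) \<le> c"
      by (subst nn_integral_distr_prob_algebra[OF ta upd f']) simp
  qed
qed

section \<open>Scores: measurability and reduction to one agent\<close>

lemma measurable_policy:
  "(\<lambda>x. \<pi> n \<theta> (fst x) (snd x)) \<in> borel_measurable (states G \<Otimes>\<^sub>M actions G)"
proof -
  have "(\<lambda>(\<theta>, s, a). \<pi> n \<theta> s a) \<in> borel_measurable (borel \<Otimes>\<^sub>M (states G \<Otimes>\<^sub>M actions G))"
    using policy by (auto simp: wf_policy_def)
  from measurable_compose[OF measurable_Pair1' this, of \<theta>] show ?thesis by (simp add: case_prod_beta)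
qed

text \<open>A directional derivative is the pointwise limit of difference quotients with step sizes
  1/(k+1), and each quotient is measurable because the policy is.\<close>

lemma measurable_score:
  "(\<lambda>x. score own \<pi> i n \<theta> (fst x) (snd x)) \<in> borel_measurable (states G \<Otimes>\<^sub>M actions G)"
proof -
  have "(\<lambda>x. frechet_derivative (\<lambda>\<theta>'. ln (\<pi> n \<theta>' (fst x) (snd x))) (at \<theta>) v)
      \<in> borel_measurable (states G \<Otimes>\<^sub>M actions G)" for v
  proof (rule borel_measurable_LIMSEQ_real)
    let ?q = "\<lambda>k x. (ln (\<pi> n (\<theta> + inverse (real (Suc k)) *\<^sub>R v) (fst x) (snd x)) - ln (\<pi> n \<theta> (fst x) (snd x)))
      / inverse (real (Suc k))"
    show "?q k \<in> borel_measurable (states G \<Otimes>\<^sub>M actions G)" for k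
      by (intro borel_measurable_divide borel_measurable_diff borel_measurable_ln measurable_policy) auto
    fix x assume "x \<in> space (states G \<Otimes>\<^sub>M actions G)"
    then have x: "fst x \<in> space (states G)" "snd x \<in> space (actions G)"
      by (auto simp: space_pair_measure)
    let ?g = "\<lambda>\<theta>'. ln (\<pi> n \<theta>' (fst x) (snd x))"
    have "?g differentiable (at \<theta>)"
      using policy x by (auto simp: wf_policy_def)
    then have g: "(?g has_derivative frechet_derivative ?g (at \<theta>)) (at \<theta>)"
      by (simp only: frechet_derivative_works)
    then have lin: "linear (frechet_derivative ?g (at \<theta>))"
      by (rule has_derivative_linear)
    \<comment> \<open>Restriction to the line through \<open>\<theta>\<close> in direction
      \<open>v\<close> turns the Frechet derivative into a derivative in one variable.\<close>
    have "((\<lambda>t. ?g (\<theta> + t *\<^sub>R v)) has_derivative (\<lambda>t. frechet_derivative ?g (at \<theta>) (t *\<^sub>R v))) (at 0)"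
      by (rule has_derivative_compose[where f="\<lambda>t. \<theta> + t *\<^sub>R v"])
        (auto intro!: derivative_eq_intros simp: g)
    then have "((\<lambda>t. ?g (\<theta> + t *\<^sub>R v)) has_field_derivative frechet_derivative ?g (at \<theta>) v) (at 0)"
      by (simp add: has_field_derivative_def linear_scale[OF lin] mult_commute_abs)
    then have "((\<lambda>t. (?g (\<theta> + t *\<^sub>R v) - ?g \<theta>) / t) \<longlongrightarrow> frechet_derivative ?g (at \<theta>) v) (at 0)"
      by (simp add: DERIV_def)
    moreover have "filterlim (\<lambda>k. inverse (real (Suc k))) (at 0) sequentially"
      using LIMSEQ_inverse_real_of_nat by (simp add: filterlim_at)
    ultimately show "(\<lambda>k. ?q k x) \<longlonglongrightarrow> frechet_derivative ?g (at \<theta>) v"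
      by (rule filterlim_compose)
  qed
  then have "(\<lambda>x. score own \<pi> i n \<theta> (fst x) (snd x) $ m) \<in> borel_measurable (states G \<Otimes>\<^sub>M actions G)" for m
    by (cases "own m = i") (simp_all add: score_def block_grad_def block_def)
  then show ?thesis
    by (subst borel_measurable_euclidean_space) (auto simp: Basis_vec_def inner_axis)
qed

text \<open>The marginal of a product of probability measures is its factor. This reduces
  expectations under the joint policy to the expectations over a single agent's action that the
  score assumption controls.\<close>

lemma nn_integral_act_action:
  assumes s: "s \<in> space (states G)" and f: "f \<in> borel_measurable (states G \<Otimes>\<^sub>M actions G)"
  shows "(\<integral>\<^sup>+x. f (fst x, snd x n) \<partial>act G \<pi> \<theta> s) = (\<integral>\<^sup>+a. f (s, a) \<partial>policy_law G \<pi> n \<theta> s)"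
proof -
  have J: "joint_policy_law G \<pi> \<theta> s \<in> space (prob_algebra (joint_actions G))"
    by (rule measurable_space[OF measurable_joint_policy_law s])
  have P: "policy_law G \<pi> m \<theta> s \<in> space (prob_algebra (actions G))" for m
    by (rule measurable_space[OF measurable_policy_law s])
  have c: "(\<lambda>a. a n) \<in> joint_actions G \<rightarrow>\<^sub>M actions G"
    by (simp add: joint_actions_def measurable_component_singleton)
  have d: "distr (joint_policy_law G \<pi> \<theta> s) (actions G) (\<lambda>a. a n) = policy_law G \<pi> n \<theta> s"
  proof -
    have "distr (joint_policy_law G \<pi> \<theta> s) (policy_law G \<pi> n \<theta> s) (\<lambda>a. a n) = policy_law G \<pi> n \<theta> s"
      unfolding joint_policy_law_def by (rule distr_PiM_component) (use P in \<open>auto simp: space_prob_algebra\<close>)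
    moreover have "sets (actions G) = sets (policy_law G \<pi> n \<theta> s)" using P by (simp add: space_prob_algebra)
    ultimately show ?thesis by (metis distr_cong)
  qed
  have sa: "(\<lambda>a. (s, a)) \<in> joint_actions G \<rightarrow>\<^sub>M SA"
    using measurable_Pair1'[OF s] by (simp add: state_actions_def)
  have fs: "(\<lambda>x. f (fst x, snd x n)) \<in> borel_measurable SA"
    by (intro measurable_compose[OF measurable_Pair f] measurable_fst_state_actions measurable_action)
  have "(\<integral>\<^sup>+x. f (fst x, snd x n) \<partial>act G \<pi> \<theta> s) = (\<integral>\<^sup>+a. f (s, a n) \<partial>joint_policy_law G \<pi> \<theta> s)"
    unfolding act_def by (subst nn_integral_distr_prob_algebra[OF J sa fs]) simp
  also have "\<dots> = (\<integral>\<^sup>+a. f (s, a) \<partial>distr (joint_policy_law G \<pi> \<theta> s) (actions G) (\<lambda>a. a n))"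
    by (subst nn_integral_distr_prob_algebra[OF J c measurable_compose[OF measurable_Pair1'[OF s] f]]) simp
  finally show ?thesis by (simp add: d)
qed

end

section \<open>Mean bounds for returns and for the gradient estimator\<close>

locale bounded_reward = markov_policy G \<pi>
  for G :: "('s, 'n::finite, 'k::finite) markov_game" and \<pi> :: "('s, 'n, 'k, 'm::finite) policy" +
  fixes R :: real
  assumes R: "R > 0" "\<And>i x. x \<in> space SA \<Longrightarrow> \<bar>reward G i x\<bar> \<le> R"
begin

text \<open>The value of the geometric series with terms
  \<open>R * \<gamma> powr (k / 2)\<close>.\<close>

definition return_bound :: real where "return_bound = R / (1 - \<gamma> powr (1 / 2))"

text \<open>The weights are powers of \<open>q = \<gamma> powr (1 / 2) < 1\<close>, so a geometric
  series bounds the return on every path and for every length.\<close>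

lemma discounted_return_le:
  assumes w: "w \<in> space (paths T)"
  shows "\<bar>\<Sum>k\<le>T. \<gamma> powr (real k / 2) * reward G i (w k)\<bar> \<le> return_bound"
proof -
  define q where "q = \<gamma> powr (1 / 2)"
  have q: "0 < q" "q < 1" using discount powr_less_mono2[of "1/2" \<gamma> 1] by (auto simp: q_def)
  have qk: "\<gamma> powr (real k / 2) = q ^ k" for k
    using discount by (simp add: q_def powr_powr flip: powr_realpow)
  have "\<bar>\<Sum>k\<le>T. \<gamma> powr (real k / 2) * reward G i (w k)\<bar> \<le> (\<Sum>k\<le>T. q ^ k * R)"
    using q R(2) measurable_space[OF component_paths w]
    by (intro order_trans[OF sum_abs] sum_mono) (auto simp: qk abs_mult intro!: mult_left_mono)
  also have "\<dots> = (\<Sum>k\<le>T. q ^ k) * R" by (simp add: sum_distrib_right)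
  also have "(\<Sum>k\<le>T. q ^ k) = (1 - q ^ Suc T) / (1 - q)"
    using q sum_gp0[of q T] by simp
  also have "\<dots> * R \<le> 1 / (1 - q) * R"
    using q R by (intro mult_right_mono divide_right_mono) auto
  finally show ?thesis by (simp add: return_bound_def q_def)
qed

lemma return_bound_nonneg: "0 \<le> return_bound"
  using discount R powr_less_mono2[of "1/2" \<gamma> 1] by (auto simp: return_bound_def)

lemma nn_integral_return_law_le:
  assumes \<mu>: "\<mu> \<in> space (prob_algebra SA)"
  shows "(\<integral>\<^sup>+x. ennreal \<bar>x\<bar> \<partial>return_law G \<pi> i \<theta> \<mu>) \<le> ennreal return_bound"
proof -
  let ?g = "\<lambda>T. distr (chain G \<pi> \<theta> \<mu> T) borel (\<lambda>w. \<Sum>k\<le>T. \<gamma> powr (real k / 2) * reward G i (w k))"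
  have chain: "chain G \<pi> \<theta> \<mu> T \<in> space (prob_algebra (paths T))" for T
    by (rule measurable_space[OF measurable_chain \<mu>])
  show ?thesis unfolding return_law_def
  proof (rule nn_integral_bind_le[where A="count_space UNIV" and B=borel])
    show "?g \<in> count_space UNIV \<rightarrow>\<^sub>M prob_algebra borel"
      using measurable_space[OF measurable_distr_prob_space[OF measurable_discounted_return] chain] by auto
    show "measure_pmf (geometric_pmf (1 - \<gamma> powr (1 / 2))) \<in> space (prob_algebra (count_space UNIV))"
      by (auto simp: space_prob_algebra measure_pmf.prob_space_axioms)
    fix T
    show "(\<integral>\<^sup>+x. ennreal \<bar>x\<bar> \<partial>?g T) \<le> ennreal return_bound"
      by (subst nn_integral_distr_prob_algebra[OF chain measurable_discounted_return])
        (auto intro!: nn_integral_le_const_prob_algebra[OF chain] ennreal_leI discounted_return_le)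
  qed simp
qed

lemma nn_integral_Q_law_le:
  "x \<in> space SA \<Longrightarrow> (\<integral>\<^sup>+q. ennreal \<bar>q\<bar> \<partial>Q_law G \<pi> i \<theta> x) \<le> ennreal return_bound"
  unfolding Q_law_def
  by (intro nn_integral_return_law_le) (auto simp: space_prob_algebra prob_space_return)

lemma nn_integral_V_law_le:
  "s \<in> space (states G) \<Longrightarrow> (\<integral>\<^sup>+v. ennreal \<bar>v\<bar> \<partial>V_law G \<pi> i \<theta> s) \<le> ennreal return_bound"
  unfolding V_law_def by (intro nn_integral_return_law_le measurable_space[OF measurable_act])

text \<open>The number \<open>q\<close> is arbitrary so that the bound serves two estimators:
  \<open>q\<close> is the estimated action value for the advantage, and the reward plus the
  discounted next value for the temporal difference.\<close>

lemma nn_integral_minus_V_law_le: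
  assumes x: "x \<in> space SA"
  shows "(\<integral>\<^sup>+y. ennreal \<bar>y\<bar> \<partial>distr (V_law G \<pi> i \<theta> (fst x)) borel (\<lambda>v. q - v)) \<le>
    ennreal \<bar>q\<bar> + ennreal return_bound"
proof -
  have s: "fst x \<in> space (states G)" by (rule measurable_space[OF measurable_fst_state_actions x])
  have V: "V_law G \<pi> i \<theta> (fst x) \<in> space (prob_algebra borel)"
    by (rule measurable_space[OF measurable_V_law s])
  interpret V: prob_space "V_law G \<pi> i \<theta> (fst x)" using V by (simp add: space_prob_algebra)
  have [measurable_cong]: "sets (V_law G \<pi> i \<theta> (fst x)) = sets borel" using V by (simp add: space_prob_algebra)
  have "(\<integral>\<^sup>+y. ennreal \<bar>y\<bar> \<partial>distr (V_law G \<pi> i \<theta> (fst x)) borel (\<lambda>v. q - v)) =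
      (\<integral>\<^sup>+v. ennreal \<bar>q - v\<bar> \<partial>V_law G \<pi> i \<theta> (fst x))"
    by (rule nn_integral_distr) measurable
  also have "\<dots> \<le> (\<integral>\<^sup>+v. ennreal \<bar>q\<bar> + ennreal \<bar>v\<bar> \<partial>V_law G \<pi> i \<theta> (fst x))"
    by (intro nn_integral_mono) (simp flip: ennreal_plus add: ennreal_leI)
  also have "\<dots> = ennreal \<bar>q\<bar> + (\<integral>\<^sup>+v. ennreal \<bar>v\<bar> \<partial>V_law G \<pi> i \<theta> (fst x))"
    by (subst nn_integral_add) (auto simp: V.emeasure_space_1)
  also have "\<dots> \<le> ennreal \<bar>q\<bar> + ennreal return_bound"
    by (intro add_left_mono nn_integral_V_law_le s)
  finally show ?thesis .
qed

text \<open>One constant covers the three kinds: the mean is at most one \<open>return_bound\<close>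
  for the action value, two for the advantage, and \<open>R\<close> plus two for the temporal
  difference.\<close>

lemma nn_integral_reward_law_le:
  assumes x: "x \<in> space SA"
  shows "(\<integral>\<^sup>+y. ennreal \<bar>y\<bar> \<partial>reward_law kd G \<pi> i \<theta> x) \<le> ennreal (R + 2 * return_bound)"
proof (cases kd)
  case Q_value
  have "ennreal return_bound \<le> ennreal (R + 2 * return_bound)"
    using R return_bound_nonneg by (intro ennreal_leI) simp
  with nn_integral_Q_law_le[OF x] show ?thesis
    unfolding reward_law_eq Q_value by (auto intro: order_trans)
next
  case Advantage
  let ?N = "\<lambda>q. distr (V_law G \<pi> i \<theta> (fst x)) borel (\<lambda>v. q - v)"
  have s: "fst x \<in> space (states G)" by (rule measurable_space[OF measurable_fst_state_actions x])
  have V: "V_law G \<pi> i \<theta> (fst x) \<in> space (prob_algebra borel)"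
    by (rule measurable_space[OF measurable_V_law s])
  have N: "?N \<in> borel \<rightarrow>\<^sub>M prob_algebra borel"
    by (intro measurable_distr_prob_space2[where M=borel] measurable_const V) measurable
  have Q: "Q_law G \<pi> i \<theta> x \<in> space (prob_algebra borel)"
    by (rule measurable_space[OF measurable_Q_law x])
  interpret Q: prob_space "Q_law G \<pi> i \<theta> x" using Q by (simp add: space_prob_algebra)
  have [measurable_cong]: "sets (Q_law G \<pi> i \<theta> x) = sets borel" using Q by (simp add: space_prob_algebra)
  have "(\<integral>\<^sup>+y. ennreal \<bar>y\<bar> \<partial>reward_law kd G \<pi> i \<theta> x) = (\<integral>\<^sup>+q. \<integral>\<^sup>+y. ennreal \<bar>y\<bar> \<partial>?N q \<partial>Q_law G \<pi> i \<theta> x)"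
    unfolding reward_law_eq Advantage using nn_integral_bind_prob_algebra[OF _ N Q, of "\<lambda>y. ennreal \<bar>y\<bar>"] by simp
  also have "\<dots> \<le> (\<integral>\<^sup>+q. ennreal \<bar>q\<bar> + ennreal return_bound \<partial>Q_law G \<pi> i \<theta> x)"
    by (intro nn_integral_mono nn_integral_minus_V_law_le x)
  also have "\<dots> = (\<integral>\<^sup>+q. ennreal \<bar>q\<bar> \<partial>Q_law G \<pi> i \<theta> x) + ennreal return_bound"
    by (subst nn_integral_add) (auto simp: Q.emeasure_space_1)
  also have "\<dots> \<le> ennreal return_bound + ennreal return_bound"
    by (intro add_right_mono nn_integral_Q_law_le x)
  also have "\<dots> \<le> ennreal (R + 2 * return_bound)"
    using R return_bound_nonneg by (simp flip: ennreal_plus add: ennreal_leI)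
  finally show ?thesis .
next
  case Temporal_difference
  let ?N = "\<lambda>v'. distr (V_law G \<pi> i \<theta> (fst x)) borel (\<lambda>v. reward G i x + \<gamma> * v' - v)"
  let ?P = "trans G x \<bind> V_law G \<pi> i \<theta>"
  have s: "fst x \<in> space (states G)" by (rule measurable_space[OF measurable_fst_state_actions x])
  have V: "V_law G \<pi> i \<theta> (fst x) \<in> space (prob_algebra borel)"
    by (rule measurable_space[OF measurable_V_law s])
  have N: "?N \<in> borel \<rightarrow>\<^sub>M prob_algebra borel"
    by (intro measurable_distr_prob_space2[where M=borel] measurable_const V) measurable
  have t: "trans G x \<in> space (prob_algebra (states G))"
    by (rule measurable_space[OF measurable_trans x])
  have P: "?P \<in> space (prob_algebra borel)"
    by (rule measurable_space[OF measurable_bind_prob_space[OF measurable_trans measurable_V_law] x])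
  interpret P: prob_space ?P using P by (simp add: space_prob_algebra)
  have [measurable_cong]: "sets ?P = sets borel" using P by (simp add: space_prob_algebra)
  have "(\<integral>\<^sup>+y. ennreal \<bar>y\<bar> \<partial>reward_law kd G \<pi> i \<theta> x) = (\<integral>\<^sup>+v'. \<integral>\<^sup>+y. ennreal \<bar>y\<bar> \<partial>?N v' \<partial>?P)"
    unfolding reward_law_eq Temporal_difference
    using nn_integral_bind_prob_algebra[OF _ N P, of "\<lambda>y. ennreal \<bar>y\<bar>"] by simp
  also have "\<dots> \<le> (\<integral>\<^sup>+v'. ennreal \<bar>reward G i x + \<gamma> * v'\<bar> + ennreal return_bound \<partial>?P)"
    by (intro nn_integral_mono nn_integral_minus_V_law_le x)
  \<comment> \<open>The factor \<open>\<gamma> < 1\<close> in front of the next value is estimated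
    by 1.\<close>
  also have "\<dots> \<le> (\<integral>\<^sup>+v'. ennreal \<bar>v'\<bar> + ennreal (R + return_bound) \<partial>?P)"
  proof (rule nn_integral_mono)
    fix v' :: real
    have "\<bar>reward G i x + \<gamma> * v'\<bar> \<le> \<bar>reward G i x\<bar> + \<bar>\<gamma> * v'\<bar>" by (rule abs_triangle_ineq)
    also have "\<dots> \<le> R + \<bar>v'\<bar>"
      using R(2)[OF x] discount by (intro add_mono) (auto simp: abs_mult intro!: mult_left_le_one_le)
    finally show "ennreal \<bar>reward G i x + \<gamma> * v'\<bar> + ennreal return_bound \<le> ennreal \<bar>v'\<bar> + ennreal (R + return_bound)"
      using R return_bound_nonneg by (simp flip: ennreal_plus add: ennreal_leI)
  qed
  also have "\<dots> = (\<integral>\<^sup>+v'. ennreal \<bar>v'\<bar> \<partial>?P) + ennreal (R + return_bound)"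
    by (subst nn_integral_add) (auto simp: P.emeasure_space_1)
  also have "\<dots> \<le> ennreal return_bound + ennreal (R + return_bound)"
    by (intro add_right_mono nn_integral_bind_le[OF _ measurable_V_law t] nn_integral_V_law_le) auto
  also have "\<dots> = ennreal (R + 2 * return_bound)"
    using R return_bound_nonneg by (simp flip: ennreal_plus)
  finally show ?thesis .
qed

text \<open>Conditioning on the recorded state-action pair separates the two factors of the
  estimator. The reward factor has a conditional mean bounded uniformly in the pair, which leaves
  the mean norm of the summed scores, at most \<open>B\<close> for each agent. The prefactor of the
  estimator contributes \<open>1 / (1 - \<gamma>)\<close>.\<close>

lemma nn_integral_estimator_law_le:
  assumes score: "\<And>n s. s \<in> space (states G) \<Longrightarrow>
      (\<integral>\<^sup>+a. ennreal (norm (score own \<pi> i n \<theta> s a)) \<partial>policy_law G \<pi> n \<theta> s) \<le> ennreal B"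
    and B: "B \<ge> 0"
  shows "(\<integral>\<^sup>+y. ennreal (norm y) \<partial>estimator_law kd G own \<pi> i \<theta>) \<le>
    ennreal ((R + 2 * return_bound) / (1 - \<gamma>) * (real CARD('n) * B))"
proof -
  define C where "C = (R + 2 * return_bound) / (1 - \<gamma>)"
  have C: "C \<ge> 0" using R return_bound_nonneg discount by (simp add: C_def)
  define U where "U x = (\<Sum>n\<in>UNIV. score own \<pi> i n \<theta> (fst x) (snd x n))" for x
  have U[measurable]: "U \<in> borel_measurable SA"
    unfolding U_def
    by (intro borel_measurable_sum measurable_compose[OF measurable_Pair measurable_score, simplified]
        measurable_fst_state_actions measurable_action)
  \<comment> \<open>\<open>E x\<close> is the conditional law of the estimator given the recorded
    pair \<open>x\<close>, and \<open>U x\<close> is the sum of the scores at that pair.\<close>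
  define E where "E x = distr (reward_law kd G \<pi> i \<theta> x) borel (\<lambda>r. (1 / (1 - \<gamma>) * r) *\<^sub>R U x)" for x
  have E: "E \<in> SA \<rightarrow>\<^sub>M prob_algebra borel"
    unfolding E_def by measurable
  have E_le: "(\<integral>\<^sup>+y. ennreal (norm y) \<partial>E x) \<le> ennreal C * ennreal (norm (U x))" if x: "x \<in> space SA" for x
  proof -
    have Rl: "reward_law kd G \<pi> i \<theta> x \<in> space (prob_algebra borel)"
      by (rule measurable_space[OF measurable_reward_law x])
    then have [measurable_cong]: "sets (reward_law kd G \<pi> i \<theta> x) = sets borel" by (simp add: space_prob_algebra)
    have "(\<integral>\<^sup>+y. ennreal (norm y) \<partial>E x) =
        (\<integral>\<^sup>+r. ennreal (norm ((1 / (1 - \<gamma>) * r) *\<^sub>R U x)) \<partial>reward_law kd G \<pi> i \<theta> x)"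
      unfolding E_def by (rule nn_integral_distr) measurable
    also have "\<dots> = (\<integral>\<^sup>+r. ennreal (norm (U x) / (1 - \<gamma>)) * ennreal \<bar>r\<bar> \<partial>reward_law kd G \<pi> i \<theta> x)"
      using discount by (intro nn_integral_cong) (simp add: abs_mult mult_ac flip: ennreal_mult)
    also have "\<dots> = ennreal (norm (U x) / (1 - \<gamma>)) * (\<integral>\<^sup>+r. ennreal \<bar>r\<bar> \<partial>reward_law kd G \<pi> i \<theta> x)"
      by (rule nn_integral_cmult) measurable
    also have "\<dots> \<le> ennreal (norm (U x) / (1 - \<gamma>)) * ennreal (R + 2 * return_bound)"
      by (intro mult_left_mono nn_integral_reward_law_le x) simp
    also have "\<dots> = ennreal C * ennreal (norm (U x))"
      using discount R return_bound_nonneg C by (simp add: C_def mult_ac del: ennreal_plus flip: ennreal_mult)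
    finally show ?thesis .
  qed
  have \<mu>: "act G \<pi> \<theta> s \<in> space (prob_algebra SA)" if "s \<in> space (states G)" for s
    using that by (rule measurable_space[OF measurable_act])
  \<comment> \<open>The triangle inequality splits the sum of scores, and each term depends on one
    agent's action only, so its mean is taken under that agent's policy. This gives the factor
    \<open>CARD('n)\<close>.\<close>
  have act_le: "(\<integral>\<^sup>+x. ennreal C * ennreal (norm (U x)) \<partial>act G \<pi> \<theta> s) \<le> ennreal (C * (real CARD('n) * B))"
    if s: "s \<in> space (states G)" for s
  proof -
    have [measurable_cong]: "sets (act G \<pi> \<theta> s) = sets SA" using \<mu>[OF s] by (simp add: space_prob_algebra)
    have sc: "(\<lambda>x. ennreal (norm (score own \<pi> i n \<theta> (fst x) (snd x)))) \<in> borel_measurable (states G \<Otimes>\<^sub>M actions G)" for n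
      using measurable_score[of own i n \<theta>] by measurable
    have scm[measurable]: "(\<lambda>x. ennreal (norm (score own \<pi> i n \<theta> (fst x) (snd x n)))) \<in> borel_measurable (act G \<pi> \<theta> s)" for n
      using measurable_compose[OF measurable_Pair[OF measurable_fst_state_actions measurable_action] sc[of n], of n]
      by (simp cong: measurable_cong_sets)
    have "(\<integral>\<^sup>+x. ennreal C * ennreal (norm (U x)) \<partial>act G \<pi> \<theta> s) = ennreal C * (\<integral>\<^sup>+x. ennreal (norm (U x)) \<partial>act G \<pi> \<theta> s)"
      by (rule nn_integral_cmult) measurable
    also have "(\<integral>\<^sup>+x. ennreal (norm (U x)) \<partial>act G \<pi> \<theta> s) \<le>
        (\<integral>\<^sup>+x. (\<Sum>n\<in>UNIV. ennreal (norm (score own \<pi> i n \<theta> (fst x) (snd x n)))) \<partial>act G \<pi> \<theta> s)"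
      unfolding U_def by (intro nn_integral_mono) (auto simp: sum_ennreal intro!: ennreal_leI norm_sum)
    also have "\<dots> = (\<Sum>n\<in>UNIV. \<integral>\<^sup>+x. ennreal (norm (score own \<pi> i n \<theta> (fst x) (snd x n))) \<partial>act G \<pi> \<theta> s)"
      by (rule nn_integral_sum) (rule scm)
    also have "\<dots> = (\<Sum>n\<in>UNIV. \<integral>\<^sup>+a. ennreal (norm (score own \<pi> i n \<theta> s a)) \<partial>policy_law G \<pi> n \<theta> s)"
      using nn_integral_act_action[OF s sc] by simp
    also have "\<dots> \<le> (\<Sum>n\<in>(UNIV::'n set). ennreal B)"
      by (intro sum_mono score s)
    also have "\<dots> = ennreal (real CARD('n) * B)"
      using B by (simp add: ennreal_mult ennreal_of_nat_eq_real_of_nat)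
    finally show ?thesis using C B by (simp add: ennreal_mult mult_left_mono)
  qed
  let ?chain = "chain G \<pi> \<theta> (act G \<pi> \<theta> (init_state G))"
  have chain: "?chain T \<in> space (prob_algebra (paths T))" for T
    by (rule measurable_space[OF measurable_chain \<mu>[OF init_state]])
  have EwT: "(\<lambda>w. E (w T)) \<in> paths T \<rightarrow>\<^sub>M prob_algebra borel" for T
    by (rule measurable_compose[OF component_paths E]) (rule order_refl)
  have "estimator_law kd G own \<pi> i \<theta> =
      measure_pmf (geometric_pmf (1 - \<gamma>)) \<bind> (\<lambda>T. ?chain T \<bind> (\<lambda>w. E (w T)))"
    by (simp add: estimator_law_def E_def U_def case_prod_beta)
  moreover have "(\<integral>\<^sup>+y. ennreal (norm y) \<partial>(measure_pmf (geometric_pmf (1 - \<gamma>)) \<bind> (\<lambda>T. ?chain T \<bind> (\<lambda>w. E (w T)))))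
     \<le> ennreal (C * (real CARD('n) * B))"
  \<comment> \<open>The bound holds at every fixed time \<open>T\<close> and so survives the mixture
    over the geometric time.\<close>
  proof (rule nn_integral_bind_le[where A="count_space UNIV" and B=borel])
    show "(\<lambda>T. ?chain T \<bind> (\<lambda>w. E (w T))) \<in> count_space UNIV \<rightarrow>\<^sub>M prob_algebra borel"
      using prob_space_bind'[OF chain EwT] sets_bind'[OF chain EwT] by (auto simp: space_prob_algebra)
    show "measure_pmf (geometric_pmf (1 - \<gamma>)) \<in> space (prob_algebra (count_space UNIV))"
      by (auto simp: space_prob_algebra measure_pmf.prob_space_axioms)
    fix T
    have sp: "space (?chain T) = space (paths T)"
      using chain[of T] by (intro sets_eq_imp_space_eq) (simp add: space_prob_algebra)
    have "(\<integral>\<^sup>+y. ennreal (norm y) \<partial>(?chain T \<bind> (\<lambda>w. E (w T)))) = (\<integral>\<^sup>+w. \<integral>\<^sup>+y. ennreal (norm y) \<partial>E (w T) \<partial>?chain T)"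
      by (rule nn_integral_bind_prob_algebra[OF _ EwT chain]) simp
    also have "\<dots> \<le> (\<integral>\<^sup>+w. ennreal C * ennreal (norm (U (w T))) \<partial>?chain T)"
      by (intro nn_integral_mono E_le) (use sp measurable_space[OF component_paths[of T T]] in auto)
    also have "\<dots> \<le> ennreal (C * (real CARD('n) * B))"
      by (rule nn_integral_chain_last_le[OF _ \<mu>[OF init_state] act_le[OF init_state] act_le]) measurable
    finally show "(\<integral>\<^sup>+y. ennreal (norm y) \<partial>(?chain T \<bind> (\<lambda>w. E (w T)))) \<le> ennreal (C * (real CARD('n) * B))" .
  qed simp
  ultimately show ?thesis by (simp add: C_def)
qed

end

section \<open>From conditional laws to expectations\<close>

text \<open>Taking the whole space as the conditioning event shows that the law of \<open>X\<close>
  is the mixture of the kernel \<open>K\<close> over \<open>M\<close>, to which the bound for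
  mixtures applies.\<close>

lemma nn_integral_cond_law_le:
  fixes c :: ennreal
  assumes c: "cond_law M F X N K" and M: "prob_space M"
    and F: "space F = space M" "sets F \<subseteq> sets M"
    and f: "f \<in> borel_measurable N"
    and le: "\<And>\<omega>. \<omega> \<in> space M \<Longrightarrow> (\<integral>\<^sup>+x. f x \<partial>K \<omega>) \<le> c"
  shows "(\<integral>\<^sup>+\<omega>. f (X \<omega>) \<partial>M) \<le> c"
proof -
  interpret prob_space M by fact
  have X: "X \<in> M \<rightarrow>\<^sub>M N" and "K \<in> F \<rightarrow>\<^sub>M prob_algebra N"
    and eq: "\<And>A C. A \<in> sets F \<Longrightarrow> C \<in> sets N \<Longrightarrow> emeasure M (A \<inter> X -` C) = (\<integral>\<^sup>+\<omega>\<in>A. emeasure (K \<omega>) C \<partial>M)"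
    using c by (auto simp: cond_law_def)
  then have K: "K \<in> M \<rightarrow>\<^sub>M prob_algebra N"
    using F measurable_mono[of "prob_algebra N" "prob_algebra N" F M] by auto
  have M': "M \<in> space (prob_algebra M)" by (simp add: space_prob_algebra prob_space_axioms)
  have "distr M N X = M \<bind> K"
  proof (rule measure_eqI)
    show "sets (distr M N X) = sets (M \<bind> K)" using sets_bind'[OF M' K] by simp
    fix C assume "C \<in> sets (distr M N X)"
    then have C: "C \<in> sets N" by simp
    have "emeasure (distr M N X) C = emeasure M (space F \<inter> X -` C)"
      using X C by (simp add: emeasure_distr F(1) Int_commute)
    also have "\<dots> = (\<integral>\<^sup>+\<omega>. emeasure (K \<omega>) C \<partial>M)"
      using F(1) by (subst eq[OF sets.top C]) (auto intro!: nn_integral_cong)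
    also have "\<dots> = emeasure (M \<bind> K) C" by (rule emeasure_bind_prob_algebra[OF M' K C, symmetric])
    finally show "emeasure (distr M N X) C = emeasure (M \<bind> K) C" .
  qed
  then have "(\<integral>\<^sup>+\<omega>. f (X \<omega>) \<partial>M) = (\<integral>\<^sup>+x. f x \<partial>(M \<bind> K))"
    using nn_integral_distr[OF X, of f] f by (metis measurable_distr_eq1)
  also have "\<dots> \<le> c" by (rule nn_integral_bind_le[OF f K M' le])
  finally show ?thesis .
qed

lemma sets_past_subset:
  assumes "\<And>t. \<Theta> t \<in> borel_measurable M" "\<And>t. \<Psi> t \<in> borel_measurable M"
  shows "sets (past M \<Theta> \<Psi> t) \<subseteq> sets M"
  unfolding past_def
  by (intro sets_image_in_sets refl measurable_restrict borel_measurable_Pair assms)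

section \<open>Mean belief errors\<close>

text \<open>The mean bound on the estimator is uniform in the parameter, so it holds at the random
  local view of each agent. The result is stated by coordinates because the belief recursion runs
  separately in each coordinate.\<close>

lemma (in bounded_reward) expected_estimate_bound:
  fixes own :: "'m \<Rightarrow> 'n" and D :: "nat \<Rightarrow> 'n \<Rightarrow> 'w \<Rightarrow> real^'m"
  assumes play: "networked_play G own \<pi> kind \<alpha> W M \<Theta> \<Psi> D" and B: "B \<ge> 0"
    and score: "\<And>i n \<theta> s. s \<in> space (states G) \<Longrightarrow>
        integrable (policy_law G \<pi> n \<theta> s) (\<lambda>a. norm (score own \<pi> i n \<theta> s a)) \<and>
        (\<integral>a. norm (score own \<pi> i n \<theta> s a) \<partial>policy_law G \<pi> n \<theta> s) \<le> B"
  obtains C where "C \<ge> 0" "\<And>t i m. integrable M (\<lambda>\<omega>. D (Suc t) i \<omega> $ m)"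
    "\<And>t i m. (\<integral>\<omega>. \<bar>D (Suc t) i \<omega> $ m\<bar> \<partial>M) \<le> C"
proof -
  define C where "C = (R + 2 * return_bound) / (1 - \<gamma>) * (real CARD('n) * B)"
  have C: "C \<ge> 0" using R return_bound_nonneg discount B by (simp add: C_def)
  interpret prob_space M using play by (simp add: networked_play_def)
  have meas: "\<Theta> t \<in> borel_measurable M" "\<Psi> t \<in> borel_measurable M" for t
    using play by (auto simp: networked_play_def)
  have "integrable M (\<lambda>\<omega>. D (Suc t) i \<omega> $ m) \<and> (\<integral>\<omega>. \<bar>D (Suc t) i \<omega> $ m\<bar> \<partial>M) \<le> C" for t i m
  proof -
    have cl: "cond_law M (past M \<Theta> \<Psi> t) (D (Suc t) i) borel
        (\<lambda>\<omega>. estimator_law (kind i) G own \<pi> i (local_view own i (\<Theta> t \<omega>) (\<Psi> t \<omega>)))"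
      using play by (simp add: networked_play_def)
    have D: "D (Suc t) i \<in> borel_measurable M" using cl by (simp add: cond_law_def)
    have "(\<integral>\<^sup>+\<omega>. ennreal (norm (D (Suc t) i \<omega>)) \<partial>M) \<le> ennreal C"
    proof (rule nn_integral_cond_law_le[OF cl prob_space_axioms])
      show "space (past M \<Theta> \<Psi> t) = space M" by (simp add: past_def)
      show "sets (past M \<Theta> \<Psi> t) \<subseteq> sets M" by (rule sets_past_subset) (rule meas)+
      fix \<omega>
      let ?\<theta> = "local_view own i (\<Theta> t \<omega>) (\<Psi> t \<omega>)"
      show "(\<integral>\<^sup>+x. ennreal (norm x) \<partial>estimator_law (kind i) G own \<pi> i ?\<theta>) \<le> ennreal C"
        unfolding C_def
      proof (rule nn_integral_estimator_law_le[OF _ B])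
        fix n s assume s: "s \<in> space (states G)"
        show "(\<integral>\<^sup>+a. ennreal (norm (score own \<pi> i n ?\<theta> s a)) \<partial>policy_law G \<pi> n ?\<theta> s) \<le> ennreal B"
          using score[OF s, of n ?\<theta> i] by (subst nn_integral_eq_integral) (auto intro: ennreal_leI)
      qed
    qed simp
    then have int: "integrable M (D (Suc t) i)" and le: "(\<integral>\<^sup>+\<omega>. ennreal (norm (D (Suc t) i \<omega>)) \<partial>M) \<le> ennreal C"
      by (auto intro!: integrableI_bounded D intro: le_less_trans)
    have int_m: "integrable M (\<lambda>\<omega>. D (Suc t) i \<omega> $ m)"
      by (rule Bochner_Integration.integrable_bound[OF int])
        (use measurable_compose[OF D borel_measurable_continuous_onI[OF continuous_on_component[OF continuous_on_id]]]
          in \<open>auto simp: component_le_norm_cart\<close>)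
    have "(\<integral>\<omega>. \<bar>D (Suc t) i \<omega> $ m\<bar> \<partial>M) \<le> (\<integral>\<omega>. norm (D (Suc t) i \<omega>) \<partial>M)"
      using int int_m by (intro integral_mono integrable_abs integrable_norm component_le_norm_cart)
    also have "\<dots> \<le> C"
      using le int C by (subst (asm) nn_integral_eq_integral) auto
    finally show ?thesis using int_m by simp
  qed
  with C show thesis using that by blast
qed

section \<open>Blocks of coordinates and the rate of the mean belief error\<close>

lemma block_diff: "block own j x - block own j y = block own j (x - y)"
  by (simp add: block_def vec_eq_iff)

lemma continuous_on_block: "continuous_on A (block own j)"
  unfolding block_def
proof (intro continuous_on_vec_lambda)
  show "continuous_on A (\<lambda>v. if own m = j then v $ m else 0)" for m
    by (cases "own m = j") (auto intro!: continuous_intros)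
qed

text \<open>Comparison with the l1 norm, used to assemble the rates of the single coordinates into a
  rate for a whole block.\<close>

lemma norm_block_le: "norm (block own j v) \<le> (\<Sum>m | own m = j. \<bar>v $ m\<bar>)"
proof -
  have "norm (block own j v) \<le> (\<Sum>m\<in>UNIV. \<bar>block own j v $ m\<bar>)" by (rule norm_le_l1_cart)
  also have "\<dots> = (\<Sum>m | own m = j. \<bar>v $ m\<bar>)"
    by (simp add: block_def if_distrib sum.If_cases cong: if_cong)
  finally show ?thesis .
qed

theorem lemma4:
  fixes G :: "('s, 'n::finite, 'k::finite) markov_game"
    and own :: "'m::finite \<Rightarrow> 'n"
    and \<pi> :: "('s, 'n, 'k, 'm) policy"
    and kind :: "'n \<Rightarrow> estimator_kind"
    and E :: "nat \<Rightarrow> ('n \<times> 'n) set"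
    and W :: "nat \<Rightarrow> 'n \<Rightarrow> real^'n^'n"
    and \<alpha> :: "nat \<Rightarrow> real"
    and M :: "'w measure"
    and \<Theta> :: "nat \<Rightarrow> 'w \<Rightarrow> real^'m"
    and \<Psi> :: "nat \<Rightarrow> 'w \<Rightarrow> real^'m^'n"
    and D :: "nat \<Rightarrow> 'n \<Rightarrow> 'w \<Rightarrow> real^'m"
    and T\<^sub>G :: nat
    and h \<kappa> \<beta> R B V L :: real
  assumes game: "wf_game G" and policy: "wf_policy G \<pi>"
    and play: "networked_play G own \<pi> kind \<alpha> W M \<Theta> \<Psi> D"
    and undirected: "\<And>t. sym (E t)"
    and A1_connected: "\<And>i j. (i, j) \<in> (limit_edges E)\<^sup>*"
    and A1_period: "T\<^sub>G > 0"
      "\<And>e t. e \<in> limit_edges E \<Longrightarrow> t \<ge> 1 \<Longrightarrow> e \<in> (\<Union>\<tau>\<in>{0..T\<^sub>G - 1}. E (t + \<tau>))"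
    and A2_h: "0 < h" "h < 1"
    and A2_nonneg: "\<And>t i j l. t \<ge> 1 \<Longrightarrow> W t j $ i $ l \<ge> 0"
    and A2_i: "\<And>t i j l. t \<ge> 1 \<Longrightarrow> i \<noteq> j \<Longrightarrow> l \<in> {l. (i, l) \<in> E t} \<union> {i} \<Longrightarrow> W t j $ i $ l \<ge> h"
      "\<And>t i j l. t \<ge> 1 \<Longrightarrow> i \<noteq> j \<Longrightarrow> l \<notin> {l. (i, l) \<in> E t} \<union> {i} \<Longrightarrow> W t j $ i $ l = 0"
    and A2_ii: "\<And>t j. t \<ge> 1 \<Longrightarrow> W t j $ j $ j = 1"
    and A2_iii: "\<And>t i j. t \<ge> 1 \<Longrightarrow> (\<Sum>l\<in>UNIV. W t j $ i $ l) = 1"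
    and A3_kappa: "\<kappa> \<ge> 0"
    and A3_mean: "\<And>i j m. i \<noteq> j \<Longrightarrow> own m = j \<Longrightarrow>
        integrable M (\<lambda>\<omega>. \<bar>\<Psi> 0 \<omega> $ i $ m - \<Theta> 0 \<omega> $ m\<bar>) \<and>
        (\<integral>\<omega>. \<bar>\<Psi> 0 \<omega> $ i $ m - \<Theta> 0 \<omega> $ m\<bar> \<partial>M) \<le> \<kappa>"
    and A3_own: "\<And>j \<omega>. \<omega> \<in> space M \<Longrightarrow> block own j (\<Psi> 0 \<omega> $ j) = block own j (\<Theta> 0 \<omega>)"
    and A4: "\<And>t. t \<ge> 1 \<Longrightarrow> \<alpha> t > 0" "\<alpha> \<in> O(\<lambda>t. real t powr (- \<beta>))" "1/2 < \<beta>" "\<beta> < 1"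
    and A5: "R > 0" "\<And>i x. x \<in> space (state_actions G) \<Longrightarrow> \<bar>reward G i x\<bar> \<le> R"
    and A6_nonneg: "B \<ge> 0" "V \<ge> 0" "L \<ge> 0"
    and A6_first: "\<And>i n \<theta> s. s \<in> space (states G) \<Longrightarrow>
        integrable (policy_law G \<pi> n \<theta> s) (\<lambda>a. norm (score own \<pi> i n \<theta> s a)) \<and>
        (\<integral>a. norm (score own \<pi> i n \<theta> s a) \<partial>policy_law G \<pi> n \<theta> s) \<le> B"
    and A6_second: "\<And>i n \<theta> s. s \<in> space (states G) \<Longrightarrow>
        integrable (policy_law G \<pi> n \<theta> s) (\<lambda>a. (norm (score own \<pi> i n \<theta> s a))\<^sup>2) \<and>
        (\<integral>a. (norm (score own \<pi> i n \<theta> s a))\<^sup>2 \<partial>policy_law G \<pi> n \<theta> s) \<le> V\<^sup>2"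
    and A6_lipschitz: "\<And>i n \<theta>1 \<theta>2 s a. s \<in> space (states G) \<Longrightarrow> a \<in> space (actions G) \<Longrightarrow>
        norm (score own \<pi> i n \<theta>1 s a - score own \<pi> i n \<theta>2 s a) \<le> L * norm (\<theta>1 - \<theta>2)"
  shows "\<forall>i j.
      (\<forall>t. integrable M (\<lambda>\<omega>. norm (block own j (\<Psi> t \<omega> $ i) - block own j (\<Theta> t \<omega>)))) \<and>
      (\<lambda>t. \<integral>\<omega>. norm (block own j (\<Psi> t \<omega> $ i) - block own j (\<Theta> t \<omega>)) \<partial>M)
        \<in> O(\<lambda>t. real t powr (- \<beta>))"
proof -
  interpret markov_policy G \<pi> by unfold_locales (fact game policy)+
  interpret bounded_reward G \<pi> R by unfold_locales (fact A5)+
  interpret M: prob_space M using play by (simp add: networked_play_def)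
  have meas: "\<Theta> t \<in> borel_measurable M" "\<Psi> t \<in> borel_measurable M" for t
    using play by (auto simp: networked_play_def)
  have \<Theta>_nth: "(\<lambda>\<omega>. \<Theta> t \<omega> $ m) \<in> borel_measurable M"
    and \<Psi>_nth: "(\<lambda>\<omega>. \<Psi> t \<omega> $ i) \<in> borel_measurable M"
    and \<Psi>_nth_nth: "(\<lambda>\<omega>. \<Psi> t \<omega> $ i $ m) \<in> borel_measurable M" for t i m
    by (intro borel_measurable_continuous_on[OF _ meas(1)] borel_measurable_continuous_on[OF _ meas(2)] continuous_intros)+
  obtain C where C: "C \<ge> 0" and D_int: "\<And>t i m. integrable M (\<lambda>\<omega>. D (Suc t) i \<omega> $ m)"
    and D_le: "\<And>t i m. (\<integral>\<omega>. \<bar>D (Suc t) i \<omega> $ m\<bar> \<partial>M) \<le> C"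
    using expected_estimate_bound[OF play A6_nonneg(1) A6_first] by blast
  obtain K where K: "K \<ge> 0" "\<And>t. t \<ge> 1 \<Longrightarrow> \<bar>\<alpha> t\<bar> \<le> K * real t powr (-\<beta>)"
    using bigo_powr_bound[OF A4(2)] by blast
  define e where "e m t i \<omega> = \<Psi> t \<omega> $ i $ m - \<Theta> t \<omega> $ m" for m t i \<omega>
  have W_sum: "(\<Sum>l\<in>UNIV. W (Suc t) j $ i $ l) = 1" for t i j
    by (rule A2_iii) simp
  \<comment> \<open>The diagonal entry already exhausts the row sum 1, so the other entries, being
    nonnegative, vanish.\<close>
  have W_j: "W (Suc t) j $ j $ l = (if l = j then 1 else 0)" for t j l
  proof (cases "l = j")
    case False
    have "(\<Sum>l\<in>UNIV - {j}. W (Suc t) j $ j $ l) = 0"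
      using W_sum[of t j j] A2_ii[of "Suc t" j] by (simp add: sum.remove[of UNIV j])
    then show ?thesis using False A2_nonneg[of "Suc t" j j] by (subst (asm) sum_nonneg_eq_0_iff) auto
  qed (use A2_ii in simp)
  have \<Theta>_step: "\<Theta> (Suc t) \<omega> $ m - \<Theta> t \<omega> $ m = \<alpha> (Suc t) * D (Suc t) (own m) \<omega> $ m"
    if "\<omega> \<in> space M" for t m \<omega>
  proof -
    have "block own (own m) (\<Theta> (Suc t) \<omega>) =
        block own (own m) (\<Theta> t \<omega>) + \<alpha> (Suc t) *\<^sub>R block own (own m) (D (Suc t) (own m) \<omega>)"
      using play that by (simp add: networked_play_def)
    from arg_cong[OF this, of "\<lambda>v. v $ m"] show ?thesis by (simp add: block_def)
  qed
  \<comment> \<open>As each row sums to 1, the new parameter can be moved under the sum. For the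
    owner of the coordinate the correction added before averaging cancels the parameter step; every
    other agent's error is shifted by that step.\<close>
  have e_step: "e m (Suc t) i \<omega> = (\<Sum>l\<in>UNIV. W (Suc t) (own m) $ i $ l *
      (e m t l \<omega> - (if l = own m then 0 else \<alpha> (Suc t) * D (Suc t) (own m) \<omega> $ m)))"
    if \<omega>: "\<omega> \<in> space M" for t m i \<omega>
  proof -
    let ?w = "\<lambda>l. W (Suc t) (own m) $ i $ l" and ?\<delta> = "\<Theta> (Suc t) \<omega> $ m - \<Theta> t \<omega> $ m"
    have "(\<chi> i. \<Psi> (Suc t) \<omega> $ i $ m) =
        W (Suc t) (own m) *v ((\<chi> i. \<Psi> t \<omega> $ i $ m) + ?\<delta> *\<^sub>R axis (own m) 1)"
      using play \<omega> by (simp add: networked_play_def)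
    from arg_cong[OF this, of "\<lambda>v. v $ i"]
    have "\<Psi> (Suc t) \<omega> $ i $ m = (\<Sum>l\<in>UNIV. ?w l * (\<Psi> t \<omega> $ l $ m + (if l = own m then ?\<delta> else 0)))"
      by (simp add: matrix_vector_mult_def axis_def if_distrib cong: if_cong)
    moreover have "\<Theta> (Suc t) \<omega> $ m = (\<Sum>l\<in>UNIV. ?w l * \<Theta> (Suc t) \<omega> $ m)"
      by (simp add: W_sum flip: sum_distrib_right)
    ultimately have "e m (Suc t) i \<omega> =
        (\<Sum>l\<in>UNIV. ?w l * (\<Psi> t \<omega> $ l $ m + (if l = own m then ?\<delta> else 0)) - ?w l * \<Theta> (Suc t) \<omega> $ m)"
      unfolding e_def by (simp only: sum_subtractf)
    also have "\<dots> = (\<Sum>l\<in>UNIV. ?w l * (e m t l \<omega> - (if l = own m then 0 else ?\<delta>)))"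
      by (intro sum.cong refl) (simp add: e_def algebra_simps)
    finally show ?thesis by (simp only: \<Theta>_step[OF \<omega>])
  qed
  \<comment> \<open>The row of the owner is a unit vector and the step term is absent at the owner,
    so an initial error of 0 persists.\<close>
  have e_own: "e m t (own m) \<omega> = 0" if \<omega>: "\<omega> \<in> space M" for m t \<omega>
  proof (induction t)
    case 0
    from arg_cong[OF A3_own[OF \<omega>, of "own m"], of "\<lambda>v. v $ m"] show ?case
      by (simp add: e_def block_def)
  next
    case (Suc t)
    then show ?case by (simp add: e_step[OF \<omega>] W_j if_distrib cong: if_cong)
  qed
  \<comment> \<open>Initially the assumption on the mean covers every agent but the owner, whose
    error is 0. The recursion then adds only integrable estimates.\<close>
  have e_int: "integrable M (e m t i)" for m t i
  proof (induction t arbitrary: i)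
    case 0
    have m: "e m 0 i \<in> borel_measurable M"
      unfolding e_def by (intro borel_measurable_diff \<Psi>_nth_nth \<Theta>_nth)
    show ?case
    proof (cases "i = own m")
      case True
      then show ?thesis using e_own by (simp cong: Bochner_Integration.integrable_cong)
    next
      case False
      then have "integrable M (\<lambda>\<omega>. \<bar>e m 0 i \<omega>\<bar>)" using A3_mean[of i "own m" m] by (simp add: e_def)
      then show ?thesis using m by (simp add: integrable_abs_iff)
    qed
  next
    case (Suc t)
    have "integrable M (\<lambda>\<omega>. if l = own m then 0 else \<alpha> (Suc t) * D (Suc t) (own m) \<omega> $ m)" for l
      using D_int by (cases "l = own m") auto
    then have "integrable M (\<lambda>\<omega>. \<Sum>l\<in>UNIV. W (Suc t) (own m) $ i $ l *
      (e m t l \<omega> - (if l = own m then 0 else \<alpha> (Suc t) * D (Suc t) (own m) \<omega> $ m)))"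
      by (intro Bochner_Integration.integrable_sum integrable_mult_right Bochner_Integration.integrable_diff Suc)
    then show ?case using e_step by (simp cong: Bochner_Integration.integrable_cong)
  qed
  define f where "f m t i = (\<integral>\<omega>. \<bar>e m t i \<omega>\<bar> \<partial>M)" for m t i
  have f_step: "f m (Suc t) i \<le> (\<Sum>l\<in>UNIV. W (Suc t) (own m) $ i $ l * f m t l) + \<bar>\<alpha> (Suc t)\<bar> * C" for m t i
  proof -
    let ?w = "\<lambda>l. W (Suc t) (own m) $ i $ l" and ?D = "\<lambda>\<omega>. D (Suc t) (own m) \<omega> $ m"
    have w: "?w l \<ge> 0" for l by (rule A2_nonneg) simp
    have "f m (Suc t) i \<le> (\<integral>\<omega>. (\<Sum>l\<in>UNIV. ?w l * \<bar>e m t l \<omega>\<bar>) + \<bar>\<alpha> (Suc t)\<bar> * \<bar>?D \<omega>\<bar> \<partial>M)"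
      unfolding f_def
    proof (rule integral_mono)
      show "integrable M (\<lambda>\<omega>. \<bar>e m (Suc t) i \<omega>\<bar>)" by (intro integrable_abs e_int)
      show "integrable M (\<lambda>\<omega>. (\<Sum>l\<in>UNIV. ?w l * \<bar>e m t l \<omega>\<bar>) + \<bar>\<alpha> (Suc t)\<bar> * \<bar>?D \<omega>\<bar>)"
        by (intro Bochner_Integration.integrable_add Bochner_Integration.integrable_sum integrable_mult_right
            integrable_abs e_int D_int)
      fix \<omega> assume \<omega>: "\<omega> \<in> space M"
      have "\<bar>e m (Suc t) i \<omega>\<bar> \<le> (\<Sum>l\<in>UNIV. \<bar>?w l * (e m t l \<omega> - (if l = own m then 0 else \<alpha> (Suc t) * ?D \<omega>))\<bar>)"
        unfolding e_step[OF \<omega>] by (rule sum_abs)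
      \<comment> \<open>The step term is estimated by its full size for the owner as well, so that
        the weights in front of it sum to 1.\<close>
      also have "\<dots> \<le> (\<Sum>l\<in>UNIV. ?w l * (\<bar>e m t l \<omega>\<bar> + \<bar>\<alpha> (Suc t) * ?D \<omega>\<bar>))"
        unfolding abs_mult[of "?w _"] abs_of_nonneg[OF w]
        by (intro sum_mono mult_left_mono w) (auto intro: order_trans[OF abs_triangle_ineq4])
      also have "\<dots> = (\<Sum>l\<in>UNIV. ?w l * \<bar>e m t l \<omega>\<bar>) + \<bar>\<alpha> (Suc t)\<bar> * \<bar>?D \<omega>\<bar>"
        by (simp add: distrib_left sum.distrib W_sum abs_mult flip: sum_distrib_right)
      finally show "\<bar>e m (Suc t) i \<omega>\<bar> \<le> (\<Sum>l\<in>UNIV. ?w l * \<bar>e m t l \<omega>\<bar>) + \<bar>\<alpha> (Suc t)\<bar> * \<bar>?D \<omega>\<bar>" .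
    qed
    also have "\<dots> = (\<Sum>l\<in>UNIV. ?w l * f m t l) + \<bar>\<alpha> (Suc t)\<bar> * (\<integral>\<omega>. \<bar>?D \<omega>\<bar> \<partial>M)"
      unfolding f_def using e_int D_int by (subst Bochner_Integration.integral_add) auto
    also have "\<dots> \<le> (\<Sum>l\<in>UNIV. ?w l * f m t l) + \<bar>\<alpha> (Suc t)\<bar> * C"
      by (intro add_left_mono mult_left_mono D_le) simp
    finally show ?thesis .
  qed
  have f_own: "f m t (own m) = 0" for m t
    unfolding f_def using e_own by (simp cong: Bochner_Integration.integral_cong)
  \<comment> \<open>Each coordinate is treated on its own, with its owner as the source. The
    perturbation is the step size times the mean bound \<open>C\<close> on the estimates, whence the
    constant \<open>K * C\<close>.\<close>
  have "\<exists>A\<ge>0. \<forall>t i. f m t i \<le> A * real (Suc t) powr (-\<beta>)" for m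
  proof (rule consensus_rate[OF A1_connected A1_period A2_h, where w="\<lambda>t i l. W t (own m) $ i $ l"
        and f="f m" and b="\<lambda>t. \<bar>\<alpha> t\<bar> * C" and K="K * C" and j="own m" and \<beta>=\<beta>])
    show "\<bar>\<alpha> t\<bar> * C \<le> K * C * real t powr (-\<beta>)" if "t \<ge> 1" for t
      using mult_right_mono[OF K(2)[OF that] C] by (simp add: mult_ac)
    show "h \<le> W t (own m) $ i $ l" if "1 \<le> t" "i \<noteq> own m" "(i, l) \<in> E t \<or> l = i" for t i l
      by (rule A2_i(1)) (use that in auto)
  qed (use A2_nonneg A2_iii f_step f_own K C A4 in auto)
  then obtain A where A: "\<And>m. A m \<ge> 0" "\<And>m t i. f m t i \<le> A m * real (Suc t) powr (-\<beta>)" by metis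
  show ?thesis
  proof (intro allI conjI)
    fix i j
    let ?g = "\<lambda>t \<omega>. norm (block own j (\<Psi> t \<omega> $ i) - block own j (\<Theta> t \<omega>))"
    let ?S = "\<Sum>m | own m = j. A m"
    have g_le: "?g t \<omega> \<le> (\<Sum>m | own m = j. \<bar>e m t i \<omega>\<bar>)" for t \<omega>
      using norm_block_le[of own j "\<Psi> t \<omega> $ i - \<Theta> t \<omega>"] by (simp add: block_diff e_def)
    have sum_int: "integrable M (\<lambda>\<omega>. \<Sum>m | own m = j. \<bar>e m t i \<omega>\<bar>)" for t
      by (intro Bochner_Integration.integrable_sum integrable_abs e_int)
    show g_int: "integrable M (?g t)" for t
    proof (rule Bochner_Integration.integrable_bound[OF sum_int])
      show "?g t \<in> borel_measurable M"
        by (intro measurable_compose[OF _ borel_measurable_norm] borel_measurable_diff borel_measurable_continuous_on[OF continuous_on_block]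
            \<Psi>_nth meas(1))
      show "AE \<omega> in M. norm (?g t \<omega>) \<le> norm (\<Sum>m | own m = j. \<bar>e m t i \<omega>\<bar>)"
        using g_le[of t] by (auto simp: sum_nonneg)
    qed
    show "(\<lambda>t. \<integral>\<omega>. ?g t \<omega> \<partial>M) \<in> O(\<lambda>t. real t powr (-\<beta>))"
    proof (rule bigoI[of _ ?S], rule eventually_at_top_linorderI[of 1])
      fix t :: nat assume t: "t \<ge> 1"
      have "(\<integral>\<omega>. ?g t \<omega> \<partial>M) \<le> (\<integral>\<omega>. (\<Sum>m | own m = j. \<bar>e m t i \<omega>\<bar>) \<partial>M)"
        by (intro integral_mono g_int sum_int g_le)
      also have "\<dots> = (\<Sum>m | own m = j. f m t i)"
        unfolding f_def by (intro Bochner_Integration.integral_sum integrable_abs e_int)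
      also have "\<dots> \<le> (\<Sum>m | own m = j. A m * real (Suc t) powr (-\<beta>))"
        by (intro sum_mono A)
      also have "\<dots> = ?S * real (Suc t) powr (-\<beta>)" by (simp add: sum_distrib_right)
      \<comment> \<open>The return from \<open>Suc t\<close> to \<open>t\<close> uses that the power
        decreases, for which the base must be positive.\<close>
      also have "\<dots> \<le> ?S * real t powr (-\<beta>)"
        using t A4 A(1) by (intro mult_left_mono powr_mono2' sum_nonneg) auto
      finally show "norm (\<integral>\<omega>. ?g t \<omega> \<partial>M) \<le> ?S * norm (real t powr (-\<beta>))" by simp
    qed
  qed
qed

end
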